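(* Let $q$ be a power of $2$ and let $G_1\le O^+(2m,q)$ be the group of all matrices $N=\begin{pmatrix}A&0&0\\ B&I_2&0\\ C&D&E\end{pmatrix}\in U(2m,\mathbb{F}_q)$, with $A,E\in U(m-1,\mathbb{F}_q)$, such that $N^TJ_{2m}N=J_{2m}$ and the matrix $S=A^TJ_{m-1}C$ satisfies $s_{ii}=b_{1i}b_{2i}$ for $i=1,\dots,m-1$. Let $h_1=\sum_{i=1}^mx_{2m-i+1}x_i$ and, for $k\ge2$, $h_k=\sum_{i=1}^m\left(x_{2m-i+1}^{q^{k-1}}x_i+x_{2m-i+1}x_i^{q^{k-1}}\right)$. Then the invariant field of $G_1$ is generated by the polynomials $N(x_i)$, $i=1,\dots,m+1$, and $h_k$, $k=1,\dots,m-1$; i.e. $$\mathbb{F}_q(V)^{G_1}=\mathbb{F}_q(x_1,N(x_2),\dots,N(x_{m+1}),h_1,\dots,h_{m-1}).$$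
   Context: $m\ge 1$, $V=\mathbb{F}_q^{2m}$ (column vectors) with $x_1,\dots,x_{2m}$ the dual basis of the standard basis; $\mathbb{F}_q[V]=\mathbb{F}_q[x_1,\dots,x_{2m}]$, $\mathbb{F}_q(V)$ is its fraction field, and $G_1$ acts by $(g\cdot f)(v)=f(g^{-1}v)$. $N(x_i)=\prod_{y\in G_1\cdot x_i}y$ is the product over the $G_1$-orbit of $x_i$ (so $N(x_1)=x_1$). $U(n,\mathbb{F})$ is the group of lower triangular $n\times n$ matrices over $\mathbb{F}$ with ones on the diagonal; $J_n$ is the $n\times n$ matrix with ones on the antidiagonal and zeros elsewhere; $b_{ij}$, $s_{ij}$ are the entries of the $2\times(m-1)$ matrix $B$ and of $S$ (blocks of size $0$ are omitted). $O^+(2m,q)$ is the group of invertible matrices preserving the quadratic form $\sum_{i=1}^mx_{2m-i+1}x_i$ on $V$. *)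

theory Defs
  imports
    "HOL-Library.Poly_Mapping"
    "HOL-Computational_Algebra.Fraction_Field"
    "HOL-Algebra.Generated_Fields"
    "HOL-Algebra.Algebraic_Closure_Type"
    "Jordan_Normal_Form.Matrix"
begin

hide_const (open) Rat.Fract

section \<open>Polynomials and rational functions\<close>

text \<open>A polynomial is a finitely supported map from monomials (exponent vectors) to
  coefficients. The type has a variable \<open>x\<^sub>i\<close> for every natural number \<open>i\<close>; the ring in
  \<open>x\<^sub>1, \<dots>, x\<^sub>n\<close> is cut out as the set \<open>polys n\<close>. Variables are numbered from 1, whereas
  matrix and vector entries in the matrix library are numbered from 0.\<close>

type_synonym 'a pol = "(nat \<Rightarrow>\<^sub>0 nat) \<Rightarrow>\<^sub>0 'a"

definition Const :: "'a::comm_ring_1 \<Rightarrow> 'a pol"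
  where "Const c = Poly_Mapping.single 0 c"

definition Var :: "nat \<Rightarrow> 'a::comm_ring_1 pol"
  where "Var i = Poly_Mapping.single (Poly_Mapping.single i 1) 1"

definition polys :: "nat \<Rightarrow> 'a::comm_ring_1 pol set"
  where "polys n = {p. \<forall>t\<in>Poly_Mapping.keys p. Poly_Mapping.keys t \<subseteq> {1..n}}"

definition subst :: "(nat \<Rightarrow> 'a pol) \<Rightarrow> 'a::comm_ring_1 pol \<Rightarrow> 'a pol"
  where "subst \<sigma> p = (\<Sum>t\<in>Poly_Mapping.keys p. Const (Poly_Mapping.lookup p t) *
           (\<Prod>i\<in>Poly_Mapping.keys t. \<sigma> i ^ Poly_Mapping.lookup t i))"

definition rat_funs :: "nat \<Rightarrow> 'a::field pol fract set"
  where "rat_funs n = {Fract p d | p d. p \<in> polys n \<and> d \<in> polys n \<and> d \<noteq> 0}"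

text \<open>\<open>adjoin S\<close> is the subfield generated by the constants and the polynomials in \<open>S\<close>.\<close>

definition adjoin :: "'a::field pol set \<Rightarrow> 'a pol fract set"
  where "adjoin S = generate_field ring_of_type_algebra
           (range (\<lambda>c. Fract (Const c) 1) \<union> (\<lambda>p. Fract p 1) ` S)"

section \<open>The action of matrices\<close>

definition mat_inv :: "'a::field mat \<Rightarrow> 'a mat"
  where "mat_inv g = inv\<^bsub>ring_mat TYPE('a) (dim_row g) ()\<^esub> g"

text \<open>The action \<open>(g \<cdot> f)(v) = f(g\<^sup>-\<^sup>1 v)\<close> sends the coordinate function \<open>x\<^sub>i\<close> to the
  linear form given by row \<open>i\<close> of \<open>g\<^sup>-\<^sup>1\<close>, and extends to an algebra homomorphism. (It has to
  be defined on polynomials rather than on functions, as the field is finite.)\<close>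

definition act_var :: "'a::field mat \<Rightarrow> nat \<Rightarrow> 'a pol"
  where "act_var g i = (\<Sum>j\<in>{1..dim_row g}. Const (mat_inv g $$ (i - 1, j - 1)) * Var j)"

definition act_poly :: "'a::field mat \<Rightarrow> 'a pol \<Rightarrow> 'a pol"
  where "act_poly g = subst (act_var g)"

text \<open>The value does not depend on the representation \<open>p/d\<close>; see \<open>act_fract_Fract\<close> below.\<close>

definition act_fract :: "'a::field mat \<Rightarrow> 'a pol fract \<Rightarrow> 'a pol fract"
  where "act_fract g f = (THE h. \<exists>p d. p \<in> polys (dim_row g) \<and> d \<in> polys (dim_row g) \<and> d \<noteq> 0 \<and>
           f = Fract p d \<and> h = Fract (act_poly g p) (act_poly g d))"

definition invariant_field :: "nat \<Rightarrow> 'a::field mat set \<Rightarrow> 'a pol fract set"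
  where "invariant_field n G = {f \<in> rat_funs n. \<forall>g\<in>G. act_fract g f = f}"

definition orbit_product :: "'a::field mat set \<Rightarrow> nat \<Rightarrow> 'a pol"
  where "orbit_product G i = (\<Prod>y\<in>(\<lambda>g. act_poly g (Var i)) ` G. y)"

section \<open>The groups\<close>

definition unitri :: "nat \<Rightarrow> 'a::field mat set"
  where "unitri n = {N \<in> carrier_mat n n. (\<forall>i<n. N $$ (i, i) = 1) \<and>
           (\<forall>i<n. \<forall>j<n. i < j \<longrightarrow> N $$ (i, j) = 0)}"

definition antidiag :: "nat \<Rightarrow> 'a::field mat"
  where "antidiag n = mat n n (\<lambda>(i, j). if i + j + 1 = n then 1 else 0)"

text \<open>The quadratic form \<open>\<Sum>\<^sub>i x\<^bsub>2m-i+1\<^esub> x\<^sub>i\<close>, with both indices shifted down by one.\<close>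

definition quad_form :: "nat \<Rightarrow> 'a::field vec \<Rightarrow> 'a"
  where "quad_form m v = (\<Sum>i=1..m. v $ (2*m - i) * v $ (i - 1))"

definition O_plus :: "nat \<Rightarrow> 'a::field mat set"
  where "O_plus m = {N \<in> carrier_mat (2*m) (2*m). invertible_mat N \<and>
           (\<forall>v\<in>carrier_vec (2*m). quad_form m (N *\<^sub>v v) = quad_form m v)}"

text \<open>The matrix with block rows \<open>(A 0 0)\<close>, \<open>(B I\<^sub>2 0)\<close>, \<open>(C D E)\<close>; the inner \<open>four_block_mat C D\<close>
  with zero-row blocks below is the horizontal concatenation \<open>(C D)\<close>.\<close>

definition block_mat ::
    "nat \<Rightarrow> 'a::field mat \<Rightarrow> 'a mat \<Rightarrow> 'a mat \<Rightarrow> 'a mat \<Rightarrow> 'a mat \<Rightarrow> 'a mat"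
  where "block_mat m A B C D E =
    four_block_mat
      (four_block_mat A (0\<^sub>m (m - 1) 2) B (1\<^sub>m 2)) (0\<^sub>m (m + 1) (m - 1))
      (four_block_mat C D (0\<^sub>m 0 (m - 1)) (0\<^sub>m 0 2)) E"

definition G1 :: "nat \<Rightarrow> 'a::field mat set"
  where "G1 m = {N \<in> O_plus m. N \<in> unitri (2*m) \<and>
    (\<exists>A B C D E. A \<in> unitri (m - 1) \<and> B \<in> carrier_mat 2 (m - 1) \<and>
       C \<in> carrier_mat (m - 1) (m - 1) \<and> D \<in> carrier_mat (m - 1) 2 \<and> E \<in> unitri (m - 1) \<and>
       N = block_mat m A B C D E \<and>
       transpose_mat N * antidiag (2*m) * N = antidiag (2*m) \<and>
       (\<forall>i<m - 1. (transpose_mat A * antidiag (m - 1) * C) $$ (i, i) = B $$ (0, i) * B $$ (1, i)))}"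

section \<open>The invariants\<close>

text \<open>The case distinction is needed: in characteristic 2 the second formula vanishes for \<open>k = 1\<close>.\<close>

definition h_pol :: "nat \<Rightarrow> nat \<Rightarrow> nat \<Rightarrow> 'a::field pol"
  where "h_pol m q k =
    (if k = 1 then \<Sum>i=1..m. Var (2*m - i + 1) * Var i
     else \<Sum>i=1..m. Var (2*m - i + 1) ^ (q ^ (k - 1)) * Var i + Var (2*m - i + 1) * Var i ^ (q ^ (k - 1)))"

section \<open>The action on rational functions is well defined\<close>

lemma poly_mapping_expand:
  fixes p :: "'k \<Rightarrow>\<^sub>0 'b::comm_monoid_add"
  shows "(\<Sum>t\<in>Poly_Mapping.keys p. Poly_Mapping.single t (Poly_Mapping.lookup p t)) = p"
proof (rule poly_mapping_eqI)
  fix s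
  have "(\<Sum>t\<in>Poly_Mapping.keys p.
        Poly_Mapping.lookup (Poly_Mapping.single t (Poly_Mapping.lookup p t)) s) =
      (\<Sum>t\<in>Poly_Mapping.keys p. if t = s then Poly_Mapping.lookup p s else 0)"
    by (intro sum.cong) (auto simp: lookup_single when_def)
  then show "Poly_Mapping.lookup
      (\<Sum>t\<in>Poly_Mapping.keys p. Poly_Mapping.single t (Poly_Mapping.lookup p t)) s =
      Poly_Mapping.lookup p s"
    by (simp add: lookup_sum in_keys_iff)
qed

lemma pol_induct [case_names single sum]:
  fixes p :: "'k \<Rightarrow>\<^sub>0 'b::comm_monoid_add"
  assumes single: "\<And>t c. P (Poly_Mapping.single t c)" and sum: "\<And>f g. P f \<Longrightarrow> P g \<Longrightarrow> P (f + g)"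
  shows "P p"
proof -
  have "P 0" using single[of undefined 0] by simp
  then have "P (\<Sum>t\<in>A. Poly_Mapping.single t (Poly_Mapping.lookup p t))" for A
    by (induction A rule: infinite_finite_induct) (auto intro: single sum)
  from this[of "Poly_Mapping.keys p"] show ?thesis by (simp add: poly_mapping_expand)
qed

lemma subst_superset:
  assumes "finite A" "Poly_Mapping.keys p \<subseteq> A"
  shows "subst \<sigma> p = (\<Sum>t\<in>A. Const (Poly_Mapping.lookup p t) *
           (\<Prod>i\<in>Poly_Mapping.keys t. \<sigma> i ^ Poly_Mapping.lookup t i))"
  unfolding subst_def
  by (rule sum.mono_neutral_left) (use assms in \<open>auto simp: Const_def in_keys_iff\<close>)

lemma Const_add: "Const (a + b) = Const a + Const b"
  by (simp add: Const_def single_add)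

lemma Const_mult: "Const (a * b) = Const a * Const b"
  by (simp add: Const_def mult_single)

lemma subst_add: "subst \<sigma> (p + q) = subst \<sigma> p + subst \<sigma> q"
proof -
  let ?A = "Poly_Mapping.keys p \<union> Poly_Mapping.keys q"
  have "Poly_Mapping.keys (p + q) \<subseteq> ?A" by (rule Poly_Mapping.keys_add)
  then show ?thesis
    by (simp add: subst_superset[of ?A] lookup_add Const_add distrib_right sum.distrib)
qed

lemma subst_0: "subst \<sigma> 0 = 0"
  by (simp add: subst_def)

lemma subst_single:
  "subst \<sigma> (Poly_Mapping.single t c) =
     Const c * (\<Prod>i\<in>Poly_Mapping.keys t. \<sigma> i ^ Poly_Mapping.lookup t i)"
  by (subst subst_superset[of "{t}"]) auto

lemma monom_add:
  fixes \<sigma> :: "nat \<Rightarrow> 'a::comm_ring_1 pol"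
  shows "(\<Prod>i\<in>Poly_Mapping.keys (s + t). \<sigma> i ^ Poly_Mapping.lookup (s + t) i) =
    (\<Prod>i\<in>Poly_Mapping.keys s. \<sigma> i ^ Poly_Mapping.lookup s i) *
    (\<Prod>i\<in>Poly_Mapping.keys t. \<sigma> i ^ Poly_Mapping.lookup t i)"
proof -
  let ?A = "Poly_Mapping.keys s \<union> Poly_Mapping.keys t"
  have *: "(\<Prod>i\<in>Poly_Mapping.keys u. \<sigma> i ^ Poly_Mapping.lookup u i) =
      (\<Prod>i\<in>?A. \<sigma> i ^ Poly_Mapping.lookup u i)" if "Poly_Mapping.keys u \<subseteq> ?A" for u
    by (rule prod.mono_neutral_left) (use that in \<open>auto simp: in_keys_iff\<close>)
  have "Poly_Mapping.keys (s + t) \<subseteq> ?A" by (rule Poly_Mapping.keys_add)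
  from *[OF this] *[of s] *[of t] show ?thesis by (simp add: lookup_add power_add prod.distrib)
qed

lemma subst_single_mult:
  "subst \<sigma> (Poly_Mapping.single s c * q) = subst \<sigma> (Poly_Mapping.single s c) * subst \<sigma> q"
proof (induction q rule: pol_induct)
  case (single t c)
  then show ?case by (simp add: mult_single subst_single monom_add Const_mult algebra_simps)
next
  case (sum f g)
  then show ?case by (simp add: distrib_left subst_add)
qed

lemma subst_mult: "subst \<sigma> (p * q) = subst \<sigma> p * subst \<sigma> q"
proof (induction p rule: pol_induct)
  case (single t c)
  then show ?case by (rule subst_single_mult)
next
  case (sum f g)
  then show ?case by (simp add: distrib_right subst_add)
qed

lemma subst_Const: "subst \<sigma> (Const c) = Const c"
  by (simp add: Const_def[of c] subst_single) 

lemma subst_Var: "subst \<sigma> (Var i) = \<sigma> i"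
  by (simp add: Var_def subst_single Const_def)

lemma subst_1: "subst \<sigma> 1 = 1"
  using subst_Const[of \<sigma> 1] by (simp add: Const_def)

lemma subst_power: "subst \<sigma> (p ^ n) = subst \<sigma> p ^ n"
  by (induction n) (auto simp: subst_1 subst_mult)

lemma subst_sum: "subst \<sigma> (\<Sum>a\<in>A. f a) = (\<Sum>a\<in>A. subst \<sigma> (f a))"
  by (induction A rule: infinite_finite_induct) (auto simp: subst_0 subst_add)

lemma subst_prod: "subst \<sigma> (\<Prod>a\<in>A. f a) = (\<Prod>a\<in>A. subst \<sigma> (f a))"
  by (induction A rule: infinite_finite_induct) (auto simp: subst_1 subst_mult)

lemma Var_power: "(Var i :: 'a::comm_ring_1 pol) ^ n = Poly_Mapping.single (Poly_Mapping.single i n) 1"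
  by (induction n) (auto simp: Var_def mult_single simp flip: single_add)

lemma prod_Var_power:
  "(\<Prod>i\<in>Poly_Mapping.keys t. Var i ^ Poly_Mapping.lookup t i) =
     (Poly_Mapping.single t 1 :: 'a::comm_ring_1 pol)"
proof -
  have "(\<Prod>i\<in>A. Var i ^ Poly_Mapping.lookup t i) = (Poly_Mapping.single
      (\<Sum>i\<in>A. Poly_Mapping.single i (Poly_Mapping.lookup t i)) 1 :: 'a pol)" for A
    by (induction A rule: infinite_finite_induct) (auto simp: Var_power mult_single)
  then show ?thesis by (simp add: poly_mapping_expand)
qed

lemma subst_Var_id: "subst Var p = p"
  by (simp add: subst_def prod_Var_power Const_def mult_single poly_mapping_expand)

lemma subst_subst_id:
  assumes "p \<in> polys n" and "\<And>i. i \<in> {1..n} \<Longrightarrow> subst \<tau> (\<sigma> i) = Var i"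
  shows "subst \<tau> (subst \<sigma> p) = p"
proof -
  have "subst \<tau> (subst \<sigma> p) = (\<Sum>t\<in>Poly_Mapping.keys p. Const (Poly_Mapping.lookup p t) *
           (\<Prod>i\<in>Poly_Mapping.keys t. subst \<tau> (\<sigma> i) ^ Poly_Mapping.lookup t i))"
    by (simp add: subst_def[of \<sigma>] subst_sum subst_mult subst_Const subst_prod subst_power)
  also have "\<dots> = subst Var p"
    unfolding subst_def[of Var]
  proof (intro sum.cong refl arg_cong2[where f = "(*)"] prod.cong)
    fix t i assume "t \<in> Poly_Mapping.keys p" "i \<in> Poly_Mapping.keys t"
    then have "i \<in> {1..n}" using assms(1) unfolding polys_def by blast
    then show "subst \<tau> (\<sigma> i) ^ Poly_Mapping.lookup t i = Var i ^ Poly_Mapping.lookup t i"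
      by (simp only: assms(2))
  qed
  finally show ?thesis by (simp add: subst_Var_id)
qed

lemma act_poly_mult: "act_poly g (p * q) = act_poly g p * act_poly g q"
  by (simp add: act_poly_def subst_mult)

lemma invertible_Units:
  assumes "g \<in> carrier_mat n n" "invertible_mat g"
  shows "g \<in> Units (ring_mat TYPE('a::field) n ())"
proof -
  obtain B where B: "g * B = 1\<^sub>m n" "B * g = 1\<^sub>m (dim_row B)"
    using assms by (auto simp: invertible_mat_def inverts_mat_def)
  have "dim_col B = n" using arg_cong[OF B(1), of dim_col] by simp
  moreover have "dim_row B = n" using arg_cong[OF B(2), of dim_col] assms by simp
  ultimately have "B \<in> carrier_mat n n" by auto
  then show ?thesis using assms B by (auto simp: Units_def ring_mat_def)
qed

lemma mat_inv:
  fixes g :: "'a::field mat"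
  assumes "g \<in> carrier_mat n n" "invertible_mat g"
  shows "mat_inv g \<in> carrier_mat n n" "mat_inv g * g = 1\<^sub>m n" "g * mat_inv g = 1\<^sub>m n"
proof -
  interpret R: ring "ring_mat TYPE('a) n ()" by (rule ring_mat)
  note u = invertible_Units[OF assms]
  have *: "mat_inv g = inv\<^bsub>ring_mat TYPE('a) n ()\<^esub> g" using assms by (simp add: mat_inv_def)
  show "mat_inv g \<in> carrier_mat n n" "mat_inv g * g = 1\<^sub>m n" "g * mat_inv g = 1\<^sub>m n"
    using R.Units_inv_closed[OF u] R.Units_l_inv[OF u] R.Units_r_inv[OF u]
    by (simp_all add: * ring_mat_simps)
qed

lemma act_poly_inj:
  fixes g :: "'a::field mat"
  assumes g: "g \<in> carrier_mat n n" "invertible_mat g" and p: "p \<in> polys n"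
    and 0: "act_poly g p = 0"
  shows "p = 0"
proof -
  define \<tau> :: "nat \<Rightarrow> 'a pol" where "\<tau> j = (\<Sum>k\<in>{1..n}. Const (g $$ (j - 1, k - 1)) * Var k)" for j
  note inv = mat_inv[OF g]
  have ent: "(\<Sum>j\<in>{1..n}. mat_inv g $$ (i - 1, j - 1) * g $$ (j - 1, k - 1)) = (if i = k then 1 else 0)"
    if "i \<in> {1..n}" "k \<in> {1..n}" for i k
  proof -
    have "(mat_inv g * g) $$ (i - 1, k - 1) =
        (\<Sum>j\<in>{0..<n}. mat_inv g $$ (i - 1, j) * g $$ (j, k - 1))"
      using that g inv(1) by (auto simp: scalar_prod_def)
    also have "\<dots> = (\<Sum>j\<in>{1..n}. mat_inv g $$ (i - 1, j - 1) * g $$ (j - 1, k - 1))"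
      by (rule sum.reindex_bij_witness[of _ "\<lambda>j. j - 1" Suc]) auto
    finally show ?thesis using that unfolding inv(2)
      by (subst (asm) index_one_mat) (auto split: if_splits)
  qed
  have "subst \<tau> (act_var g i) = Var i" if i: "i \<in> {1..n}" for i
  proof -
    have "subst \<tau> (act_var g i) = (\<Sum>j\<in>{1..n}. \<Sum>k\<in>{1..n}.
        Const (mat_inv g $$ (i - 1, j - 1) * g $$ (j - 1, k - 1)) * Var k)"
      using g by (simp add: act_var_def subst_sum subst_mult subst_Const subst_Var \<tau>_def
          sum_distrib_left Const_mult mult.assoc)
    also have "\<dots> = (\<Sum>k\<in>{1..n}. \<Sum>j\<in>{1..n}.
        Const (mat_inv g $$ (i - 1, j - 1) * g $$ (j - 1, k - 1)) * Var k)"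
      by (rule sum.swap)
    also have "\<dots> = (\<Sum>k\<in>{1..n}.
        Const (\<Sum>j\<in>{1..n}. mat_inv g $$ (i - 1, j - 1) * g $$ (j - 1, k - 1)) * Var k)"
    proof -
      have "Const (\<Sum>j\<in>A. f j) = (\<Sum>j\<in>A. Const (f j))" for f :: "nat \<Rightarrow> 'a" and A
        by (induction A rule: infinite_finite_induct) (auto simp: Const_add, auto simp: Const_def)
      then show ?thesis by (simp add: sum_distrib_right)
    qed
    also have "\<dots> = (\<Sum>k\<in>{1..n}. if i = k then Var k else 0)"
      by (intro sum.cong refl, subst ent[OF i]) (auto simp: Const_def)
    also have "\<dots> = Var i" using i by simp
    finally show ?thesis .
  qed
  then have "subst \<tau> (act_poly g p) = p"
    unfolding act_poly_def by (rule subst_subst_id[OF p])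
  then show ?thesis using 0 by (simp add: subst_0)
qed

lemma act_fract_Fract:
  fixes g :: "'a::field mat"
  assumes g: "g \<in> carrier_mat n n" "invertible_mat g"
    and pd: "p \<in> polys n" "d \<in> polys n" "d \<noteq> 0"
  shows "act_fract g (Fract p d) = Fract (act_poly g p) (act_poly g d)"
  unfolding act_fract_def
proof (rule the_equality)
  show "\<exists>p' d'. p' \<in> polys (dim_row g) \<and> d' \<in> polys (dim_row g) \<and> d' \<noteq> 0 \<and>
      Fract p d = Fract p' d' \<and> Fract (act_poly g p) (act_poly g d) = Fract (act_poly g p') (act_poly g d')"
    using assms by auto
next
  fix h
  assume "\<exists>p' d'. p' \<in> polys (dim_row g) \<and> d' \<in> polys (dim_row g) \<and> d' \<noteq> 0 \<and>
      Fract p d = Fract p' d' \<and> h = Fract (act_poly g p') (act_poly g d')"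
  then obtain p' d' where *: "p' \<in> polys n" "d' \<in> polys n" "d' \<noteq> 0"
      "Fract p d = Fract p' d'" "h = Fract (act_poly g p') (act_poly g d')"
    using g by auto
  have "p * d' = p' * d" using * pd by (simp add: eq_fract)
  then have "act_poly g p * act_poly g d' = act_poly g p' * act_poly g d"
    by (metis act_poly_mult)
  moreover have "act_poly g d \<noteq> 0" "act_poly g d' \<noteq> 0"
    using act_poly_inj[OF g] pd * by blast+
  ultimately show "h = Fract (act_poly g p) (act_poly g d)"
    using * by (simp add: eq_fract)
qed

end

theory Submission
  imports Defs "HOL-Computational_Algebra.Polynomial"
begin

text \<open>Write \<open>i' = 2m + 1 - i\<close> and \<open>s = min(i, i')\<close>. Climb from \<open>K\<^sub>0\<close>, the field generated by the claimed
  generators, to the full function field through \<open>K\<^sub>i = K\<^bsub>i-1\<^esub>(x\<^sub>i)\<close>. Let \<open>F\<^sub>s(T)\<close> be the product of all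
  \<open>T + u\<close> with \<open>u\<close> in the span of \<open>x\<^sub>1, \<dots>, x\<^bsub>s-1\<^esub>\<close>. Then \<open>x\<^sub>i\<close> is a root of the polynomial
  \<open>F\<^sub>s(T) - F\<^sub>s(x\<^sub>i)\<close> over \<open>K\<^bsub>i-1\<^esub>\<close>: for \<open>i \<le> m + 1\<close> because \<open>F\<^sub>s(x\<^sub>i) = N(x\<^sub>i)\<close>, and for larger \<open>i\<close> by applying
  the quadratic form to the vector of all \<open>F\<^sub>s(x\<^sub>j)\<close> and expanding \<open>F\<^sub>s\<close> into Frobenius powers. Its roots
  \<open>x\<^sub>i + u\<close> are all images of \<open>x\<^sub>i\<close> under elements of \<open>G\<^sub>1\<close> that fix \<open>x\<^sub>1, \<dots>, x\<^bsub>i-1\<^esub>\<close>, so an invariant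
  element of \<open>K\<^sub>i\<close> already lies in \<open>K\<^bsub>i-1\<^esub>\<close>.\<close>

section \<open>Subfields and simple extensions\<close>

text \<open>The obstacle is the upper half: for i > m + 1 the variables x_j with j >= i are still
  missing from the field, while h_1, ..., h_s mix all of them with their Frobenius powers. The
  additive polynomial F_s is the combination that eliminates at once every missing variable except
  x_i, because it vanishes at their partners x_1, ..., x_{s-1}. As s <= m - 1 there, the list of
  generators can stop at h_{m-1}. The index m + 1 still belongs to the lower half: the quadratic
  form forces the coefficient of x_m in an image of x_{m+1} to vanish, so its orbit is a coset of
  the span of x_1, ..., x_{m-1}, as min(i, i') predicts. In characteristic 2 the condition on S says
  that the form vanishes on the first m - 1 columns; hence G_1 consists of all unitriangular
  isometries and contains the transvections that shift x_i. Counting roots against these shifts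
  takes the place of field degrees and of the order of G_1.\<close>

definition subfield_set :: "'a::field set \<Rightarrow> bool"
  where "subfield_set K \<longleftrightarrow> 1 \<in> K \<and> (\<forall>x\<in>K. \<forall>y\<in>K. x - y \<in> K \<and> x * y \<in> K) \<and> (\<forall>x\<in>K. inverse x \<in> K)"

context
  fixes K :: "'a::field set"
  assumes K: "subfield_set K"
begin

lemma subfield_one: "1 \<in> K"
  and subfield_diff: "x \<in> K \<Longrightarrow> y \<in> K \<Longrightarrow> x - y \<in> K"
  and subfield_mult: "x \<in> K \<Longrightarrow> y \<in> K \<Longrightarrow> x * y \<in> K"
  and subfield_inverse: "x \<in> K \<Longrightarrow> inverse x \<in> K"
  using K by (auto simp: subfield_set_def)

lemma subfield_zero: "0 \<in> K"
  using subfield_diff[OF subfield_one subfield_one] by simp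

lemma subfield_uminus: "x \<in> K \<Longrightarrow> - x \<in> K"
  using subfield_diff[OF subfield_zero] by simp

lemma subfield_add: "x \<in> K \<Longrightarrow> y \<in> K \<Longrightarrow> x + y \<in> K"
  using subfield_diff[OF _ subfield_uminus] by force

lemma subfield_divide: "x \<in> K \<Longrightarrow> y \<in> K \<Longrightarrow> x / y \<in> K"
  by (simp add: divide_inverse subfield_mult subfield_inverse)

lemma subfield_power: "x \<in> K \<Longrightarrow> x ^ n \<in> K"
  by (induction n) (auto intro: subfield_one subfield_mult)

lemma subfield_sum: "(\<And>i. i \<in> A \<Longrightarrow> f i \<in> K) \<Longrightarrow> sum f A \<in> K"
  by (induction A rule: infinite_finite_induct) (auto intro: subfield_zero subfield_add)

lemma subfield_prod: "(\<And>i. i \<in> A \<Longrightarrow> f i \<in> K) \<Longrightarrow> prod f A \<in> K"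
  by (induction A rule: infinite_finite_induct) (auto intro: subfield_one subfield_mult)

end

lemmas subfield_intros = subfield_one subfield_zero subfield_diff subfield_add subfield_uminus
  subfield_mult subfield_inverse subfield_divide subfield_power subfield_sum subfield_prod

section \<open>Polynomials over a subfield and simple extensions\<close>

definition polys_over :: "'a::field set \<Rightarrow> 'a poly set"
  where "polys_over K = {p. \<forall>i. Polynomial.coeff p i \<in> K}"

lemma polys_over_pCons [simp]: "pCons c p \<in> polys_over K \<longleftrightarrow> c \<in> K \<and> p \<in> polys_over K"
  by (auto simp: polys_over_def coeff_pCons split: nat.splits)

context
  fixes K :: "'a::field set"
  assumes K: "subfield_set K"
begin

lemma polys_over_zero: "0 \<in> polys_over K"
  and polys_over_one: "1 \<in> polys_over K"
  and polys_over_add: "p \<in> polys_over K \<Longrightarrow> r \<in> polys_over K \<Longrightarrow> p + r \<in> polys_over K"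
  and polys_over_diff: "p \<in> polys_over K \<Longrightarrow> r \<in> polys_over K \<Longrightarrow> p - r \<in> polys_over K"
  and polys_over_smult: "c \<in> K \<Longrightarrow> p \<in> polys_over K \<Longrightarrow> smult c p \<in> polys_over K"
  and polys_over_mult: "p \<in> polys_over K \<Longrightarrow> r \<in> polys_over K \<Longrightarrow> p * r \<in> polys_over K"
  by (auto simp: polys_over_def coeff_mult coeff_1 intro!: subfield_intros[OF K])

lemma polys_over_prod: "(\<And>i. i \<in> A \<Longrightarrow> f i \<in> polys_over K) \<Longrightarrow> prod f A \<in> polys_over K"
  by (induction A rule: infinite_finite_induct) (auto intro: polys_over_one polys_over_mult)

lemma poly_in_subfield: "p \<in> polys_over K \<Longrightarrow> t \<in> K \<Longrightarrow> poly p t \<in> K"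
  by (induction p) (auto intro!: subfield_intros[OF K])

end

text \<open>The field generated by \<open>K\<close> and \<open>t\<close>, for \<open>t\<close>
  algebraic or transcendental alike: quotients of polynomial values are taken as they come, without
  a minimal polynomial or a normal form.\<close>

definition simple_ext :: "'a::field set \<Rightarrow> 'a \<Rightarrow> 'a set"
  where "simple_ext K t =
    {poly a t / poly b t | a b. a \<in> polys_over K \<and> b \<in> polys_over K \<and> poly b t \<noteq> 0}"

lemma simple_ext_subset:
  assumes "subfield_set K" "subfield_set R" "K \<subseteq> R" "t \<in> R"
  shows "simple_ext K t \<subseteq> R"
proof -
  have "polys_over K \<subseteq> polys_over R" using assms(3) by (auto simp: polys_over_def)
  then show ?thesis
    using assms unfolding simple_ext_def by (auto intro!: subfield_divide poly_in_subfield)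
qed

lemma subfield_simple_ext:
  assumes K: "subfield_set K"
  shows "subfield_set (simple_ext K t)" "K \<subseteq> simple_ext K t" "t \<in> simple_ext K t"
proof -
  have I: "poly a t / poly b t \<in> simple_ext K t"
    if "a \<in> polys_over K" "b \<in> polys_over K" "poly b t \<noteq> 0" for a b
    using that unfolding simple_ext_def by blast
  note one = polys_over_one[OF K]
  show K': "K \<subseteq> simple_ext K t"
    using I[OF _ one, of "[:_:]"] polys_over_zero[OF K] by force
  show "t \<in> simple_ext K t"
    using I[OF _ one, of "[:0, 1:]"] polys_over_zero[OF K] subfield_intros(1,2)[OF K] by simp
  have 1: "x - y \<in> simple_ext K t \<and> x * y \<in> simple_ext K t"
    if xy: "x \<in> simple_ext K t" "y \<in> simple_ext K t" for x y
  proof -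
    obtain a b where x: "x = poly a t / poly b t" "a \<in> polys_over K" "b \<in> polys_over K" "poly b t \<noteq> 0"
      using xy unfolding simple_ext_def by blast
    obtain c d where y: "y = poly c t / poly d t" "c \<in> polys_over K" "d \<in> polys_over K" "poly d t \<noteq> 0"
      using xy unfolding simple_ext_def by blast
    have "x - y = poly (a * d - c * b) t / poly (b * d) t" "x * y = poly (a * c) t / poly (b * d) t"
      using x y by (simp_all add: diff_frac_eq)
    then show ?thesis
      using x y I[of "a * d - c * b" "b * d"] I[of "a * c" "b * d"]
      by (simp add: polys_over_mult[OF K] polys_over_diff[OF K])
  qed
  have 2: "inverse x \<in> simple_ext K t" if x0: "x \<in> simple_ext K t" for x
  proof (cases "x = 0")
    case True
    then show ?thesis using x0 by simp
  next
    case False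
    obtain a b where x: "x = poly a t / poly b t" "a \<in> polys_over K" "b \<in> polys_over K" "poly b t \<noteq> 0"
      using x0 unfolding simple_ext_def by blast
    then have "inverse x = poly b t / poly a t" "poly a t \<noteq> 0" using False by auto
    then show ?thesis using I x by simp
  qed
  show "subfield_set (simple_ext K t)"
    using 1 2 K' subfield_one[OF K] unfolding subfield_set_def by blast
qed

section \<open>Homomorphisms on a subfield and their fixed elements\<close>

text \<open>Relative to a set \<open>R\<close>, because a matrix acts meaningfully only on rational
  functions in its own variables and not on the whole type.\<close>

definition hom_on :: "'a::field set \<Rightarrow> ('a \<Rightarrow> 'a) \<Rightarrow> bool"
  where "hom_on R \<sigma> \<longleftrightarrow> \<sigma> 1 = 1 \<and>
    (\<forall>x\<in>R. \<forall>y\<in>R. \<sigma> (x - y) = \<sigma> x - \<sigma> y \<and> \<sigma> (x * y) = \<sigma> x * \<sigma> y)"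

context
  fixes R :: "'a::field set" and \<sigma> :: "'a \<Rightarrow> 'a"
  assumes R: "subfield_set R" and \<sigma>: "hom_on R \<sigma>"
begin

lemma hom_on_simps:
  "\<sigma> 1 = 1" "x \<in> R \<Longrightarrow> y \<in> R \<Longrightarrow> \<sigma> (x - y) = \<sigma> x - \<sigma> y"
  "x \<in> R \<Longrightarrow> y \<in> R \<Longrightarrow> \<sigma> (x * y) = \<sigma> x * \<sigma> y"
  using \<sigma> by (auto simp: hom_on_def)

lemma hom_on_zero: "\<sigma> 0 = 0"
  using hom_on_simps(2)[of 1 1] subfield_one[OF R] by simp

lemma hom_on_add: "x \<in> R \<Longrightarrow> y \<in> R \<Longrightarrow> \<sigma> (x + y) = \<sigma> x + \<sigma> y"
  using hom_on_simps(2)[of x "- y"] hom_on_simps(2)[of 0 y] hom_on_zero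
    subfield_uminus[OF R] subfield_zero[OF R] by simp

lemma hom_on_inverse:
  assumes "x \<in> R"
  shows "\<sigma> (inverse x) = inverse (\<sigma> x)"
proof (cases "x = 0")
  case False
  then have "\<sigma> x * \<sigma> (inverse x) = 1"
    using hom_on_simps(3)[OF assms subfield_inverse[OF R assms]] hom_on_simps(1) by simp
  then show ?thesis by (simp add: inverse_unique)
qed (simp add: hom_on_zero)

text \<open>Reduces the claim that a generated field is fixed to a check on its generators.\<close>

lemma subfield_fixed: "subfield_set {x \<in> R. \<sigma> x = x}"
  unfolding subfield_set_def
  by (auto simp: hom_on_simps hom_on_inverse intro: subfield_intros[OF R])

lemma hom_on_poly:
  assumes "K \<subseteq> R" "t \<in> R" "\<And>x. x \<in> K \<Longrightarrow> \<sigma> x = x" "p \<in> polys_over K"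
  shows "\<sigma> (poly p t) = poly p (\<sigma> t)"
  using assms(4)
proof (induction p)
  case (pCons c p)
  have c: "c \<in> K" "p \<in> polys_over K" using pCons(3) by simp_all
  then have "p \<in> polys_over R" using assms(1) by (auto simp: polys_over_def)
  then have "poly p t \<in> R" using poly_in_subfield[OF R] assms(2) by blast
  then show ?case
    using pCons(2) c assms(1-3) by (auto simp: hom_on_add hom_on_simps subfield_mult[OF R])
qed (simp add: hom_on_zero)

end

section \<open>Reduction modulo a monic polynomial and descent to the base field\<close>

lemma prod_linear_monic:
  fixes U :: "'a::field set"
  assumes "finite U"
  shows "Polynomial.coeff (\<Prod>u\<in>U. [:u, 1:]) (card U) = 1"
    and "i > card U \<Longrightarrow> Polynomial.coeff (\<Prod>u\<in>U. [:u, 1:]) i = 0"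
proof -
  have "degree (\<Prod>u\<in>U. [:u, 1:]) = card U"
    by (subst degree_prod_eq_sum_degree) auto
  moreover have "lead_coeff (\<Prod>u\<in>U. [:u, 1:]) = 1"
    by (simp add: lead_coeff_prod)
  ultimately show "Polynomial.coeff (\<Prod>u\<in>U. [:u, 1:]) (card U) = 1"
    "i > card U \<Longrightarrow> Polynomial.coeff (\<Prod>u\<in>U. [:u, 1:]) i = 0"
    by (auto simp: coeff_eq_0)
qed

text \<open>Division with remainder by the monic polynomial p(T) - p(t), where p(T) is the product
  of all T + u. It lies over \<open>K\<close> and has the root \<open>t\<close>, so passing to the
  remainder keeps the value at \<open>t\<close>. The induction is Horner's scheme: multiply by T,
  then reduce once.\<close>

lemma reduce_poly_over:
  fixes K :: "'a::field set"
  assumes K: "subfield_set K" and U: "finite U" "U \<noteq> {}" "U \<subseteq> K"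
    and v: "(\<Prod>u\<in>U. t + u) \<in> K" and a: "a \<in> polys_over K"
  shows "\<exists>r\<in>polys_over K. (\<forall>i\<ge>card U. Polynomial.coeff r i = 0) \<and> poly r t = poly a t"
  using a
proof (induction a)
  case 0
  then show ?case by (intro bexI[of _ 0]) auto
next
  case (pCons c a)
  then obtain r where r: "r \<in> polys_over K" "\<And>i. i \<ge> card U \<Longrightarrow> Polynomial.coeff r i = 0"
    "poly r t = poly a t" by auto
  have d: "card U > 0" using U by (simp add: card_gt_0_iff)
  define p where "p = (\<Prod>u\<in>U. [:u, 1:])"
  define l where "l = Polynomial.coeff r (card U - 1)"
  have p: "p \<in> polys_over K" unfolding p_def
    using U subfield_one[OF K] polys_over_zero[OF K] by (intro polys_over_prod[OF K]) auto
  have pt: "poly p t = (\<Prod>u\<in>U. t + u)" by (simp add: p_def poly_prod add.commute)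
  have l: "l \<in> K" using r by (auto simp: l_def polys_over_def)
  \<comment> \<open>This is T r(T) minus \<open>l\<close> times p(T) - p(t). The factor
    \<open>l\<close> is the coefficient that multiplication by T has moved to degree
    \<open>card U\<close>; as \<open>card U > 0\<close>, the constant correction stays below that
    degree.\<close>
  let ?s = "pCons c r - smult l p + [:l * poly p t:]"
  have "?s \<in> polys_over K"
    using p l r pCons v polys_over_zero[OF K]
    by (intro polys_over_add[OF K] polys_over_diff[OF K] polys_over_smult[OF K])
       (auto simp: pt intro: subfield_mult[OF K])
  moreover have "Polynomial.coeff ?s i = 0" if "i \<ge> card U" for i
  proof -
    obtain j where "i = Suc j" using \<open>i \<ge> card U\<close> d by (cases i) auto
    then show ?thesis
      using that r(2)[of j] prod_linear_monic[OF U(1), folded p_def]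
      by (cases "i = card U") (auto simp: l_def)
  qed
  moreover have "poly ?s t = poly (pCons c a) t" using r by simp
  ultimately show ?case by blast
qed

text \<open>If \<open>f = a(t)/b(t)\<close> with \<open>a\<close>, \<open>b\<close> of degree below \<open>card U\<close> is fixed by all the \<open>\<sigma>\<close>, then
  \<open>a - f b\<close> vanishes at the \<open>card U\<close> points \<open>t + u\<close>, so \<open>f\<close> is a quotient of coefficients.\<close>

lemma fixed_in_base:
  fixes K R :: "'a::field set"
  assumes K: "subfield_set K" and R: "subfield_set R" and KR: "K \<subseteq> R" and t: "t \<in> R"
    and U: "finite U" "U \<noteq> {}" "U \<subseteq> K" and v: "(\<Prod>u\<in>U. t + u) \<in> K"
    and f: "f \<in> simple_ext K t"
    and \<sigma>: "\<And>u. u \<in> U \<Longrightarrow> \<exists>\<sigma>. hom_on R \<sigma> \<and> (\<forall>x\<in>K. \<sigma> x = x) \<and> \<sigma> t = t + u \<and> \<sigma> f = f"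
  shows "f \<in> K"
proof -
  obtain a' b' where ab': "f = poly a' t / poly b' t" "a' \<in> polys_over K" "b' \<in> polys_over K"
      "poly b' t \<noteq> 0"
    using f unfolding simple_ext_def by blast
  obtain a where a: "a \<in> polys_over K" "\<And>i. i \<ge> card U \<Longrightarrow> Polynomial.coeff a i = 0"
      "poly a t = poly a' t"
    using reduce_poly_over[OF K U v ab'(2)] by blast
  obtain b where b: "b \<in> polys_over K" "\<And>i. i \<ge> card U \<Longrightarrow> Polynomial.coeff b i = 0"
      "poly b t = poly b' t"
    using reduce_poly_over[OF K U v ab'(3)] by blast
  have fR: "f \<in> R" using f simple_ext_subset[OF K R KR t] by blast
  have fb: "poly a t = f * poly b t" using ab' a b by simp
  define p where "p = a - smult f b"
  have "poly p (t + u) = 0" if u: "u \<in> U" for u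
  proof -
    obtain \<sigma> where s: "hom_on R \<sigma>" "\<And>x. x \<in> K \<Longrightarrow> \<sigma> x = x" "\<sigma> t = t + u" "\<sigma> f = f"
      using \<sigma>[OF u] by blast
    have "b \<in> polys_over R" using b KR by (auto simp: polys_over_def)
    then have "poly b t \<in> R" using poly_in_subfield[OF R] t by blast
    then have "\<sigma> (poly a t) = f * \<sigma> (poly b t)"
      using hom_on_simps(3)[OF R s(1) fR] s(4) fb by simp
    then show ?thesis
      using hom_on_poly[OF R s(1) KR t s(2) a(1)] hom_on_poly[OF R s(1) KR t s(2) b(1)]
      by (simp add: p_def s(3))
  qed
  then have roots: "(\<lambda>u. t + u) ` U \<subseteq> {x. poly p x = 0}" by auto
  have "p = 0"
  proof (rule ccontr)
    assume "p \<noteq> 0"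
    then have "degree p < card U"
      using a(2) b(2) by (intro degree_lessI) (auto simp: p_def)
    moreover have "card ((\<lambda>u. t + u) ` U) \<le> card {x. poly p x = 0}"
      using roots poly_roots_finite[OF \<open>p \<noteq> 0\<close>] by (rule card_mono[rotated])
    moreover have "card ((\<lambda>u. t + u) ` U) = card U" by (rule card_image) (auto simp: inj_on_def)
    ultimately show False using card_poly_roots_bound[OF \<open>p \<noteq> 0\<close>] by linarith
  qed
  then have "a = smult f b" by (simp add: p_def)
  moreover have "b \<noteq> 0" using b ab' by auto
  then obtain j where "Polynomial.coeff b j \<noteq> 0" by (metis leading_coeff_0_iff)
  ultimately have "f = Polynomial.coeff a j / Polynomial.coeff b j" by simp
  then show ?thesis using a(1) b(1) by (auto simp: polys_over_def intro: subfield_divide[OF K])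
qed

subsection \<open>The field generated by polynomials\<close>

text \<open>\<open>adjoin\<close> is built on the record-based \<open>generate_field\<close>;
  identifying the record's inverses with those of the type class makes it an ordinary
  \<open>subfield_set\<close>.\<close>

lemma m_inv_ring_of_type:
  assumes "(x::'a::field) \<noteq> 0"
  shows "inv\<^bsub>ring_of_type_algebra\<^esub> x = inverse x"
proof -
  interpret F: field "ring_of_type_algebra :: 'a ring" by (rule field_from_type_algebra)
  show ?thesis
    by (rule F.comm_inv_char) (use assms in \<open>auto simp: ring_of_type_algebra_def\<close>)
qed

lemma a_inv_ring_of_type: "\<ominus>\<^bsub>ring_of_type_algebra\<^esub> (x::'a::field) = - x"
proof -
  interpret F: field "ring_of_type_algebra :: 'a ring" by (rule field_from_type_algebra)
  show ?thesis
    by (rule F.minus_equality) (auto simp: ring_of_type_algebra_def)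
qed

lemma subfield_generate_field: "subfield_set (generate_field ring_of_type_algebra (H :: 'a::field set))"
  (is "subfield_set ?K")
proof -
  have 1: "1 \<in> ?K" using generate_field.one[of ring_of_type_algebra H] by (simp add: ring_of_type_algebra_def)
  have add: "x + y \<in> ?K" and mult: "x * y \<in> ?K" if "x \<in> ?K" "y \<in> ?K" for x y
    using generate_field.eng_add[OF that] generate_field.eng_mult[OF that]
    by (simp_all add: ring_of_type_algebra_def)
  have neg: "- x \<in> ?K" if "x \<in> ?K" for x
    using generate_field.a_inv[OF that] by (simp add: a_inv_ring_of_type)
  have inv: "inverse x \<in> ?K" if "x \<in> ?K" for x
  proof (cases "x = 0")
    case False
    then show ?thesis using generate_field.m_inv[OF that]
      by (simp add: m_inv_ring_of_type) (simp add: ring_of_type_algebra_def)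
  qed (use that in simp)
  show ?thesis
    unfolding subfield_set_def using 1 mult inv add[OF _ neg] by force
qed

lemma generate_field_subset:
  fixes H :: "'a::field set"
  assumes K: "subfield_set K" and "H \<subseteq> K"
  shows "generate_field ring_of_type_algebra H \<subseteq> K"
proof
  fix x assume "x \<in> generate_field ring_of_type_algebra H"
  then show "x \<in> K"
  proof induction
    case (a_inv h)
    then show ?case by (simp add: a_inv_ring_of_type subfield_uminus[OF K])
  next
    case (m_inv h)
    have "h \<noteq> 0" using m_inv by (simp add: ring_of_type_algebra_def)
    then show ?case using m_inv by (simp add: m_inv_ring_of_type subfield_inverse[OF K])
  qed (use assms in \<open>auto simp: ring_of_type_algebra_def subfield_intros[OF K]\<close>)
qed

lemma subfield_adjoin: "subfield_set (adjoin S)"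
  unfolding adjoin_def by (rule subfield_generate_field)

lemma adjoin_subset:
  assumes "subfield_set K" "\<And>c. Fract (Const c) 1 \<in> K" "\<And>p. p \<in> S \<Longrightarrow> Fract p 1 \<in> K"
  shows "adjoin S \<subseteq> K"
  unfolding adjoin_def by (rule generate_field_subset) (use assms in auto)

lemma const_in_adjoin: "Fract (Const c) 1 \<in> adjoin S"
  and gen_in_adjoin: "p \<in> S \<Longrightarrow> Fract p 1 \<in> adjoin S"
  unfolding adjoin_def by (auto intro!: generate_field.incl)

section \<open>Frobenius powers\<close>

text \<open>Multiplication by a nonzero \<open>c\<close> permutes the nonzero elements; comparing
  their products gives exponent q - 1.\<close>

lemma finite_field_power_card_eq:
  fixes c :: "'a::{finite,field}"
  shows "c ^ card (UNIV :: 'a set) = c"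
proof (cases "c = 0")
  case False
  define A where "A = (UNIV :: 'a set) - {0}"
  have "(\<Prod>x\<in>A. c * x) = (\<Prod>x\<in>A. x)"
    by (rule prod.reindex_bij_witness[of _ "\<lambda>x. x / c" "\<lambda>x. c * x"]) (use False in \<open>auto simp: A_def\<close>)
  then have "c ^ card A * \<Prod>A = \<Prod>A" by (simp add: prod.distrib)
  moreover have "\<Prod>A \<noteq> 0" by (simp add: A_def)
  ultimately have "c ^ card A = 1" by simp
  moreover have "card (UNIV :: 'a set) = Suc (card A)"
    unfolding A_def by (subst card_Suc_Diff1) auto
  ultimately show ?thesis by simp
qed (simp add: zero_power card_gt_0_iff)

text \<open>The sum of all field elements is unchanged by the shift x to x + 1, so the number of
  elements is zero in the field.\<close>

lemma two_eq_zero_finite_field: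
  assumes "card (UNIV :: 'a::{finite,field} set) = 2 ^ r"
  shows "(1::'a) + 1 = 0"
proof -
  have "(\<Sum>x\<in>UNIV. x + (1::'a)) = (\<Sum>x\<in>UNIV. x)"
    by (rule sum.reindex_bij_witness[of _ "\<lambda>x. x - 1" "\<lambda>x. x + 1"]) auto
  then have "of_nat (2 ^ r) = (0::'a)" by (simp add: sum.distrib assms)
  then show ?thesis by simp
qed

lemma freshmans_dream_two:
  assumes "(1::'b::comm_ring_1) + 1 = 0"
  shows "((x::'b) + y) ^ (2 ^ n) = x ^ (2 ^ n) + y ^ (2 ^ n)"
proof -
  have "of_nat 2 = (0::'b)" using assms by simp
  then have "CHAR('b) dvd 2" by (simp only: of_nat_eq_0_iff_char_dvd)
  then have "CHAR('b) \<le> 2" "CHAR('b) \<noteq> 0" by (auto dest: dvd_imp_le intro: ccontr)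
  then have "CHAR('b) = 2" using CHAR_not_1[where ?'a = 'b] by linarith
  then show ?thesis by (intro freshmans_dream') simp_all
qed

lemma freshmans_dream_two_sum:
  assumes "(1::'b::comm_ring_1) + 1 = 0"
  shows "(\<Sum>i\<in>A. f i :: 'b) ^ (2 ^ n) = (\<Sum>i\<in>A. f i ^ (2 ^ n))"
  by (induction A rule: infinite_finite_induct)
     (simp_all add: freshmans_dream_two[OF assms] zero_power)

section \<open>The quadratic form and its polarization\<close>

text \<open>Takes functions of an index over any commutative ring, so that one form serves scalars,
  polynomials and rational functions.\<close>

definition quad :: "nat \<Rightarrow> (nat \<Rightarrow> 'b::comm_ring_1) \<Rightarrow> 'b"
  where "quad m v = (\<Sum>i=1..m. v (2*m + 1 - i) * v i)"

definition bil :: "nat \<Rightarrow> (nat \<Rightarrow> 'b::comm_ring_1) \<Rightarrow> (nat \<Rightarrow> 'b) \<Rightarrow> 'b"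
  where "bil m v w = (\<Sum>i=1..m. v (2*m + 1 - i) * w i + v i * w (2*m + 1 - i))"

lemma quad_cong:
  assumes "\<And>i. i \<in> {1..2*m} \<Longrightarrow> v i = w i"
  shows "quad m v = quad m w"
  unfolding quad_def
proof (intro sum.cong refl)
  fix i assume "i \<in> {1..m}"
  then have "i \<in> {1..2*m}" "2*m + 1 - i \<in> {1..2*m}" by auto
  then show "v (2*m + 1 - i) * v i = w (2*m + 1 - i) * w i"
    by (simp only: assms)
qed

lemma bil_cong:
  assumes "\<And>i. i \<in> {1..2*m} \<Longrightarrow> v i = v' i" "\<And>i. i \<in> {1..2*m} \<Longrightarrow> w i = w' i"
  shows "bil m v w = bil m v' w'"
  unfolding bil_def
proof (intro sum.cong refl)
  fix i assume "i \<in> {1..m}"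
  then have "i \<in> {1..2*m}" "2*m + 1 - i \<in> {1..2*m}" by auto
  then show "v (2*m + 1 - i) * w i + v i * w (2*m + 1 - i) = v' (2*m + 1 - i) * w' i + v' i * w' (2*m + 1 - i)"
    by (simp only: assms)
qed

lemma quad_add: "quad m (\<lambda>i. v i + w i) = quad m v + quad m w + bil m v w"
  by (simp add: quad_def bil_def algebra_simps sum.distrib)

lemma bil_commute: "bil m v w = bil m w v"
  unfolding bil_def by (intro sum.cong) (simp_all add: algebra_simps)

lemma bil_zero: "bil m v (\<lambda>i. 0) = 0"
  by (simp add: bil_def)

lemma bil_add: "bil m v (\<lambda>i. w i + w' i) = bil m v w + bil m v w'"
  by (simp add: bil_def algebra_simps sum.distrib)

lemma bil_sum: "bil m v (\<lambda>i. \<Sum>j\<in>A. w j i) = (\<Sum>j\<in>A. bil m v (w j))"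
  by (induction A rule: infinite_finite_induct) (simp_all add: bil_zero bil_add)

lemma bil_sum_left: "bil m (\<lambda>i. \<Sum>j\<in>A. w j i) v = (\<Sum>j\<in>A. bil m (w j) v)"
  by (simp add: bil_commute[of m _ v] bil_sum)

lemma quad_scale: "quad m (\<lambda>i. c * v i) = c ^ 2 * quad m v"
  by (simp add: quad_def sum_distrib_left power2_eq_square algebra_simps)

lemma bil_scale: "bil m (\<lambda>i. c * v i) (\<lambda>i. d * w i) = c * d * bil m v w"
  by (simp add: bil_def sum_distrib_left algebra_simps)

text \<open>Each unordered pair occurs once, through \<open>j < l\<close>: in characteristic 2 the
  cross terms cannot be written as half of a symmetric double sum.\<close>

lemma quad_sum:
  fixes A :: "nat set"
  assumes "finite A"
  shows "quad m (\<lambda>i. \<Sum>j\<in>A. w j i) =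
    (\<Sum>j\<in>A. quad m (w j)) + (\<Sum>l\<in>A. \<Sum>j\<in>{j\<in>A. j < l}. bil m (w j) (w l))"
  using assms
proof (induction A rule: finite_linorder_max_induct)
  case empty
  then show ?case by (simp add: quad_def)
next
  case (insert b A)
  have b: "b \<notin> A" and 1: "{j \<in> insert b A. j < b} = A" using insert by auto
  have 2: "{j \<in> insert b A. j < l} = {j \<in> A. j < l}" if "l \<in> A" for l
    using insert.hyps(2)[rule_format, OF that] by auto
  have "(\<Sum>l\<in>A. \<Sum>j\<in>{j\<in>insert b A. j < l}. bil m (w j) (w l)) =
    (\<Sum>l\<in>A. \<Sum>j\<in>{j\<in>A. j < l}. bil m (w j) (w l))"
    by (rule sum.cong) (simp_all only: 2)
  moreover have "quad m (\<lambda>i. \<Sum>j\<in>insert b A. w j i) = quad m (w b) + quad m (\<lambda>i. \<Sum>j\<in>A. w j i)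
      + (\<Sum>j\<in>A. bil m (w j) (w b))"
    using insert.hyps(1) b by (simp add: quad_add bil_sum bil_commute[of m "w b"])
  moreover have "(\<Sum>l\<in>insert b A. \<Sum>j\<in>{j\<in>insert b A. j < l}. bil m (w j) (w l)) =
      (\<Sum>j\<in>A. bil m (w j) (w b)) + (\<Sum>l\<in>A. \<Sum>j\<in>{j\<in>insert b A. j < l}. bil m (w j) (w l))"
    by (simp only: sum.insert[OF insert.hyps(1) b] 1)
  moreover have "(\<Sum>j\<in>insert b A. quad m (w j)) = quad m (w b) + (\<Sum>j\<in>A. quad m (w j))"
    using insert.hyps(1) b by simp
  ultimately show ?case using insert.IH by (simp only: add_ac)
qed

lemma quad_scaled_sum:
  fixes A :: "nat set"
  assumes "finite A"
  shows "quad m (\<lambda>i. \<Sum>j\<in>A. c j * w j i) = (\<Sum>j\<in>A. c j ^ 2 * quad m (w j)) +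
    (\<Sum>l\<in>A. \<Sum>j\<in>{j\<in>A. j < l}. c j * c l * bil m (w j) (w l))"
  by (simp add: quad_sum[OF assms] quad_scale bil_scale)

lemma bil_scaled_sum:
  "bil m (\<lambda>i. \<Sum>j\<in>A. c j * v j i) (\<lambda>i. \<Sum>l\<in>B. d l * w l i) =
    (\<Sum>j\<in>A. \<Sum>l\<in>B. c j * d l * bil m (v j) (w l))"
  by (simp only: bil_sum_left) (simp only: bil_sum bil_scale)

lemma h_pol_1: "h_pol m q 1 = quad m Var"
  unfolding h_pol_def quad_def by (auto intro!: sum.cong arg_cong2[where f = "(*)"] arg_cong[where f = Var])

text \<open>The higher invariants are values of the polar form at the coordinate vector and one of
  its Frobenius twists. Both their invariance and their later use rest on this reading.\<close>

lemma h_pol_Suc: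
  assumes "k > 0"
  shows "h_pol m q (Suc k) = bil m (\<lambda>i. Var i ^ q ^ k) Var"
  using assms unfolding h_pol_def bil_def
  by (auto intro!: sum.cong arg_cong2[where f = "(+)"] arg_cong2[where f = "(*)"]
      arg_cong2[where f = power] arg_cong[where f = Var] simp: mult.commute)

section \<open>Linear forms\<close>

definition emb :: "'a::field pol \<Rightarrow> 'a pol fract"
  where "emb p = Fract p 1"

lemma emb_0: "emb 0 = 0" and emb_1: "emb 1 = 1"
  and emb_add: "emb (x + y) = emb x + emb y" and emb_mult: "emb (x * y) = emb x * emb y"
  and emb_diff: "emb (x - y) = emb x - emb y"
  and emb_eq_iff: "emb x = emb y \<longleftrightarrow> x = y"
  by (simp_all add: emb_def eq_fract Zero_fract_def One_fract_def)

lemma emb_uminus: "emb (- x) = - emb x"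
  using emb_diff[of 0 x] by (simp add: emb_0)

lemma emb_power: "emb (x ^ n) = emb x ^ n"
  by (induction n) (simp_all add: emb_1 emb_mult)

lemma emb_sum: "emb (sum f A) = (\<Sum>i\<in>A. emb (f i))"
  by (induction A rule: infinite_finite_induct) (simp_all add: emb_0 emb_add)

lemma emb_prod: "emb (prod f A) = (\<Prod>i\<in>A. emb (f i))"
  by (induction A rule: infinite_finite_induct) (simp_all add: emb_1 emb_mult)

lemma emb_quad: "emb (quad m v) = quad m (\<lambda>i. emb (v i))"
  by (simp add: quad_def emb_sum emb_mult)

lemma emb_bil: "emb (bil m v w) = bil m (\<lambda>i. emb (v i)) (\<lambda>i. emb (w i))"
  by (simp add: bil_def emb_sum emb_mult emb_add)

lemma Const_0: "Const 0 = 0" and Const_1: "Const 1 = 1"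
  by (simp_all add: Const_def)

lemma Const_diff: "Const (a - b) = Const a - Const b"
  using Const_add[of "a - b" b] by simp

lemma Const_uminus: "Const (- a) = - Const a"
  using Const_diff[of 0 a] by (simp add: Const_0)

lemma Const_power: "Const (a ^ n) = Const a ^ n"
  by (induction n) (simp_all add: Const_1 Const_mult)

lemma Const_sum: "Const (sum f A) = (\<Sum>i\<in>A. Const (f i))"
  by (induction A rule: infinite_finite_induct) (simp_all add: Const_0 Const_add)

lemma Const_eq_iff: "Const a = Const b \<longleftrightarrow> a = b"
  unfolding Const_def by (metis lookup_single_eq)

definition lin_form :: "nat set \<Rightarrow> (nat \<Rightarrow> 'a) \<Rightarrow> 'a::field pol"
  where "lin_form A c = (\<Sum>j\<in>A. Const (c j) * Var j)"

definition lin_span :: "nat \<Rightarrow> 'a::field pol set"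
  where "lin_span s = range (lin_form {1..<s})"

lemma lookup_lin_form:
  assumes "finite A"
  shows "Poly_Mapping.lookup (lin_form A c) (Poly_Mapping.single s 1) = (if s \<in> A then c s else 0)"
proof -
  have "Poly_Mapping.lookup (lin_form A c) (Poly_Mapping.single s 1) =
      (\<Sum>j\<in>A. if s = j then c j else 0)"
    unfolding lin_form_def lookup_sum
    by (intro sum.cong) (auto simp: Const_def Var_def mult_single lookup_single when_def
        dest: arg_cong[where f = "\<lambda>t. Poly_Mapping.lookup t s"])
  also have "\<dots> = (if s \<in> A then c s else 0)" using assms by simp
  finally show ?thesis .
qed

lemma lin_form_add: "lin_form A (\<lambda>j. c j + d j) = lin_form A c + lin_form A d"
  by (simp add: lin_form_def Const_add algebra_simps sum.distrib)

lemma lin_span_1: "lin_span 1 = {0}"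
  by (auto simp: lin_span_def lin_form_def)

lemma lin_span_zero: "0 \<in> lin_span s"
  by (auto simp: lin_span_def lin_form_def Const_0 intro!: image_eqI[of _ _ "\<lambda>_. 0"])

lemma lin_span_add: "u \<in> lin_span s \<Longrightarrow> v \<in> lin_span s \<Longrightarrow> u + v \<in> lin_span s"
  unfolding lin_span_def by (auto simp flip: lin_form_add)

lemma lin_span_scale: "u \<in> lin_span s \<Longrightarrow> Const c * u \<in> lin_span s"
proof -
  have "Const c * lin_form A d = lin_form A (\<lambda>j. c * d j)" for A d
    by (simp add: lin_form_def sum_distrib_left Const_mult mult.assoc)
  then show "u \<in> lin_span s \<Longrightarrow> Const c * u \<in> lin_span s" by (auto simp: lin_span_def)
qed

lemma lin_span_sum: "(\<And>i. i \<in> A \<Longrightarrow> f i \<in> lin_span s) \<Longrightarrow> sum f A \<in> lin_span s"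
  by (induction A rule: infinite_finite_induct) (auto intro: lin_span_zero lin_span_add)

lemma lin_span_Suc:
  assumes "s \<ge> 1"
  shows "(lin_span (Suc s) :: 'a::field pol set) = (\<lambda>(c, u). Const c * Var s + u) ` (UNIV \<times> lin_span s)"
proof -
  have *: "lin_form {1..<Suc s} c = Const (c s) * Var s + lin_form {1..<s} c" for c :: "nat \<Rightarrow> 'a::field"
    using assms by (simp add: lin_form_def add.commute)
  show ?thesis
  proof (intro equalityI subsetI)
    fix x :: "'a pol" assume "x \<in> (\<lambda>(c, u). Const c * Var s + u) ` (UNIV \<times> lin_span s)"
    then obtain c d where "x = Const c * Var s + lin_form {1..<s} d" by (auto simp: lin_span_def)
    moreover have "lin_form {1..<s} d = lin_form {1..<s} (d(s := c))"
      by (simp add: lin_form_def)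
    ultimately have "x = lin_form {1..<Suc s} (d(s := c))" by (simp only: * fun_upd_same)
    then show "x \<in> lin_span (Suc s)" by (simp add: lin_span_def)
  next
    fix x :: "'a pol" assume "x \<in> lin_span (Suc s)"
    then obtain c where "x = lin_form {1..<Suc s} c" unfolding lin_span_def by blast
    then have "x = (case (c s, lin_form {1..<s} c) of (c, u) \<Rightarrow> Const c * Var s + u)" by (simp only: * case_prod_conv)
    then show "x \<in> (\<lambda>(c, u). Const c * Var s + u) ` (UNIV \<times> lin_span s)"
      unfolding lin_span_def by (rule image_eqI) simp
  qed
qed

lemma Var_in_lin_span: "j \<in> {1..<s} \<Longrightarrow> Var j \<in> lin_span s"
proof -
  assume j: "j \<in> {1..<s}"
  have "lin_form {1..<s} (\<lambda>i. if i = j then 1 else 0) = (\<Sum>i\<in>{1..<s}. if i = j then Var i else 0)"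
    unfolding lin_form_def by (intro sum.cong) (simp_all add: Const_0 Const_1)
  then have "lin_form {1..<s} (\<lambda>i. if i = j then 1 else 0) = Var j"
    using j by simp
  then show "Var j \<in> lin_span s" unfolding lin_span_def by (metis rangeI)
qed

text \<open>Compare coefficients at the monomial \<open>Var s\<close>, which does not occur in
  \<open>lin_span s\<close>. This yields unique decompositions in the next larger span and the
  nonvanishing of F_s(x_s).\<close>

lemma lin_span_Var_coeff:
  assumes "Const c * Var s + u = Const d * Var s + v" "u \<in> lin_span s" "v \<in> lin_span s"
  shows "c = d"
proof -
  have "Poly_Mapping.lookup (Const e * Var s) (Poly_Mapping.single s 1) = e" for e :: 'a
    using lookup_lin_form[of "{s}" "\<lambda>_. e" s] by (simp add: lin_form_def)
  moreover have "Poly_Mapping.lookup u (Poly_Mapping.single s 1) = 0"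
    "Poly_Mapping.lookup v (Poly_Mapping.single s 1) = 0"
    using assms(2,3) by (auto simp: lin_span_def lookup_lin_form simp del: One_nat_def)
  ultimately show ?thesis
    using arg_cong[OF assms(1), of "\<lambda>p. Poly_Mapping.lookup p (Poly_Mapping.single s 1)"]
    by (simp add: lookup_add del: One_nat_def)
qed

lemma finite_lin_span: "finite (lin_span s :: 'a::{finite,field} pol set)"
proof (induction s)
  case 0
  then show ?case by (simp add: lin_span_def lin_form_def image_def)
next
  case (Suc s)
  then show ?case
    by (cases "s = 0") (simp_all add: lin_span_1[simplified] lin_span_Suc)
qed

section \<open>Products over spans of variables\<close>

text \<open>As polynomials in S both sides are monic of degree q and, for \<open>Y\<close> nonzero,
  share the q roots \<open>h c * Y\<close>. The map \<open>h\<close> stands for the embedding of the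
  constants into the function field.\<close>

lemma prod_translates:
  fixes h :: "'a::{finite,field} \<Rightarrow> 'b::field"
  assumes h: "inj h" "\<And>a b. h (a * b) = h a * h b" "\<And>a. h (- a) = - h a" "h 1 = 1"
    and q: "q = card (UNIV :: 'a set)"
  shows "(\<Prod>c\<in>UNIV. S + h c * Y) = S ^ q - Y ^ (q - 1) * S"
proof (cases "Y = 0")
  case True
  have "card {0::'a, 1} \<le> q" unfolding q by (rule card_mono) auto
  then have "q \<ge> 2" by simp
  then show ?thesis using True by (simp add: q zero_power)
next
  case False
  have "card {0::'a, 1} \<le> q" unfolding q by (rule card_mono) auto
  then have q2: "q \<ge> 2" by simp
  define U where "U = (\<lambda>c. h c * Y) ` UNIV"
  have inj: "inj (\<lambda>c. h c * Y)" using h(1) False by (auto simp: inj_def)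
  have U: "finite U" "card U = q" by (simp_all add: U_def q card_image[OF inj])
  have h_power: "h (c ^ n) = h c ^ n" for c n by (induction n) (simp_all add: h)
  define R where "R = (\<Prod>u\<in>U. [:u, 1:])"
  \<comment> \<open>The leading terms cancel and q >= 2 keeps the linear term below degree q, so q
    distinct roots force \<open>P = 0\<close>.\<close>
  define P where "P = Polynomial.monom 1 q - Polynomial.monom (Y ^ (q - 1)) 1 - R"
  have P0: "poly P (h c * Y) = 0" for c
  proof -
    have "- h c * Y \<in> U" by (auto simp: U_def simp flip: h(3))
    then have "poly R (h c * Y) = 0"
      using U by (auto simp: R_def poly_prod intro!: bexI[of _ "- h c * Y"])
    moreover have "h c ^ q = h c"
      using finite_field_power_card_eq[of c] by (simp add: q flip: h_power)
    moreover have "Y ^ q = Y ^ (q - 1) * Y" using q2 by (metis power_minus_mult pos2 order_less_le_trans)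
    ultimately show ?thesis
      by (simp add: P_def poly_monom power_mult_distrib)
  qed
  have "P = 0"
  proof (rule ccontr)
    assume P: "P \<noteq> 0"
    have "Polynomial.coeff P i = 0" if "i \<ge> q" for i
      using that prod_linear_monic[OF U(1)] U(2) q2
      by (cases "i = q") (auto simp: P_def R_def)
    then have "degree P < q" using P by (intro degree_lessI) auto
    moreover have "card U \<le> card {x. poly P x = 0}"
      using P0 poly_roots_finite[OF P] by (intro card_mono) (auto simp: U_def)
    ultimately show False using card_poly_roots_bound[OF P] U(2) by linarith
  qed
  then have "poly P S = 0" by simp
  then have "poly R S = S ^ q - Y ^ (q - 1) * S"
    by (simp add: P_def poly_monom)
  moreover have "poly R S = (\<Prod>c\<in>UNIV. S + h c * Y)"
    unfolding R_def U_def by (subst prod.reindex[OF inj]) (simp add: poly_prod add.commute)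
  ultimately show ?thesis by simp
qed

text \<open>The F_s of the overview, known as the subspace polynomial of the span of x_1, ...,
  x_{s-1}, taken as a function on the field.\<close>

definition span_prod :: "nat \<Rightarrow> 'a::{finite,field} pol fract \<Rightarrow> 'a pol fract"
  where "span_prod s T = (\<Prod>u\<in>lin_span s. T + emb u)"

lemma span_prod_Suc_translates:
  fixes T :: "'a::{finite,field} pol fract"
  assumes "s \<ge> 1"
  shows "span_prod (Suc s) T = (\<Prod>c\<in>UNIV. span_prod s (T + emb (Const c) * emb (Var s)))"
proof -
  have "inj_on (\<lambda>(c, u). Const c * Var s + u) (UNIV \<times> (lin_span s :: 'a pol set))"
  proof (rule inj_onI)
    fix x y :: "'a \<times> 'a pol"
    assume "x \<in> UNIV \<times> lin_span s" "y \<in> UNIV \<times> lin_span s"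
      "(case x of (c, u) \<Rightarrow> Const c * Var s + u) = (case y of (c, u) \<Rightarrow> Const c * Var s + u)"
    then obtain c u d v where xy: "x = (c, u)" "y = (d, v)" "u \<in> lin_span s" "v \<in> lin_span s"
        "Const c * Var s + u = Const d * Var s + v"
      by auto
    then have "c = d" by (blast intro: lin_span_Var_coeff)
    then show "x = y" using xy by simp
  qed
  then have "span_prod (Suc s) T = (\<Prod>(c, u)\<in>UNIV \<times> lin_span s. T + emb (Const c * Var s + u))"
    unfolding span_prod_def lin_span_Suc[OF assms] by (subst prod.reindex) (auto simp: case_prod_unfold)
  also have "\<dots> = (\<Prod>c\<in>UNIV. \<Prod>u\<in>lin_span s. T + emb (Const c * Var s + u))"
    by (simp add: prod.cartesian_product)
  finally show ?thesis by (simp add: span_prod_def emb_add emb_mult add.assoc)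
qed

lemma emb_two: "(1::'a::field) + 1 = 0 \<Longrightarrow> (1::'a pol fract) + 1 = 0"
  using emb_add[of "Const (1::'a)" "Const 1"] Const_add[of "1::'a" 1] by (simp add: Const_0 Const_1 emb_0 emb_1)

text \<open>Splitting off the coefficient of x_s and using that F_s is additive, the product over
  translates becomes the recursion F_{s+1}(T) = F_s(T)^q - F_s(x_s)^(q-1) F_s(T), which keeps the
  shape of a q-polynomial.\<close>

lemma span_prod_q_polynomial:
  fixes K :: "'a::{finite,field} pol fract set"
  assumes q: "q = card (UNIV :: 'a set)" "q = 2 ^ r" and K: "subfield_set K"
    and gens: "\<And>c. emb (Const c) \<in> K" "\<And>j. j \<in> {1..<s} \<Longrightarrow> emb (Var j) \<in> K" and s: "s \<ge> 1"
  shows "\<exists>c. (\<forall>b. c b \<in> K) \<and> (\<forall>T. span_prod s T = (\<Sum>b<s. c b * T ^ (q ^ b)))"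
  using s gens
proof (induction s rule: dec_induct)
  case base
  show ?case
    by (rule exI[of _ "\<lambda>_. 1"]) (simp add: span_prod_def lin_span_1[simplified] emb_0 subfield_one[OF K])
next
  case (step s)
  then obtain c where c: "\<And>b. c b \<in> K" "\<And>T. span_prod s T = (\<Sum>b<s. c b * T ^ (q ^ b))"
    by auto
  have two: "(1::'a) + 1 = 0" using two_eq_zero_finite_field[where ?'a = 'a] q by metis
  have frob: "(x + y) ^ (q ^ b) = x ^ (q ^ b) + y ^ (q ^ b)" for x y :: "'a pol fract" and b
    unfolding q(2) power_mult[symmetric] by (rule freshmans_dream_two[OF emb_two[OF two]])
  have frob_sum: "(\<Sum>i\<in>A. f i) ^ q = (\<Sum>i\<in>A. f i ^ q)" for f :: "nat \<Rightarrow> 'a pol fract" and A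
    unfolding q(2) by (rule freshmans_dream_two_sum[OF emb_two[OF two]])
  have const: "emb (Const a) ^ (q ^ b) = emb (Const a)" for a :: 'a and b
  proof -
    have "a ^ (q ^ b) = a"
      by (induction b) (simp_all add: power_mult q(1) finite_field_power_card_eq)
    then show ?thesis by (simp flip: emb_power Const_power)
  qed
  \<comment> \<open>The only new quantity in the recursion; it lies in \<open>K\<close> because x_s
    is available for the span of index s + 1.\<close>
  define v :: "'a pol fract" where "v = span_prod s (emb (Var s))"
  have vK: "v \<in> K" unfolding v_def c(2) using c(1) step.prems(2)[of s] step.hyps
    by (intro subfield_intros[OF K]) auto
  \<comment> \<open>A q-polynomial is additive, and linear over the constants since these are fixed
    by the q-th power.\<close>
  have lin: "span_prod s (T + emb (Const a) * emb (Var s)) = span_prod s T + emb (Const a) * v" for a T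
    by (simp add: c(2) v_def frob power_mult_distrib const distrib_left sum.distrib sum_distrib_left mult_ac)
  have "span_prod (Suc s) T = span_prod s T ^ q - v ^ (q - 1) * span_prod s T" for T
    unfolding span_prod_Suc_translates[OF step.hyps(1)] lin
    by (rule prod_translates[where h = "\<lambda>a. emb (Const a)"])
       (simp_all add: inj_def emb_eq_iff Const_eq_iff Const_mult emb_mult Const_1 emb_1 q(1)
         Const_uminus emb_uminus)
  moreover have "(T ^ (q ^ b)) ^ q = T ^ (q ^ Suc b)" for T :: "'a pol fract" and b
    by (simp only: power_Suc power_mult[symmetric] mult.commute)
  ultimately have rec: "span_prod (Suc s) T =
      (\<Sum>b<s. c b ^ q * T ^ (q ^ Suc b)) - (\<Sum>b<s. v ^ (q - 1) * c b * T ^ (q ^ b))" for T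
    by (simp only: c(2) frob_sum power_mult_distrib sum_distrib_left mult.assoc)
  \<comment> \<open>The q-th power of F_s moves coefficients up by one index, whence
    \<open>c (b - 1) ^ q\<close>; the case distinctions treat the two ends.\<close>
  define c' where "c' b = (if b = 0 then 0 else c (b - 1) ^ q) - (if b < s then v ^ (q - 1) * c b else 0)" for b
  have "c' b \<in> K" for b
    unfolding c'_def using c(1) vK by (auto intro!: subfield_intros[OF K])
  moreover have "span_prod (Suc s) T = (\<Sum>b<Suc s. c' b * T ^ (q ^ b))" for T
  proof -
    have "(\<Sum>b<Suc s. (if b = 0 then 0 else c (b - 1) ^ q) * T ^ (q ^ b)) = (\<Sum>b<s. c b ^ q * T ^ (q ^ Suc b))"
      by (subst sum.lessThan_Suc_shift) simp
    moreover have "(\<Sum>b<Suc s. (if b < s then v ^ (q - 1) * c b else 0) * T ^ (q ^ b)) =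
        (\<Sum>b<s. v ^ (q - 1) * c b * T ^ (q ^ b))"
      by simp
    ultimately show ?thesis by (simp only: rec c'_def left_diff_distrib sum_subtractf)
  qed
  ultimately show ?case by blast
qed

section \<open>Isometries and the group\<close>

lemma char_two:
  assumes "(1::'b::comm_ring_1) + 1 = 0"
  shows "(x::'b) + x = 0"
proof -
  have "x + x = x * (1 + 1)" by (simp only: distrib_left mult_1_right)
  then show ?thesis by (simp only: assms mult_zero_right)
qed

text \<open>Summed over all indices, the polar form visibly has the Gram matrix
  \<open>antidiag (2*m)\<close>.\<close>

lemma bil_alt: "bil m v w = (\<Sum>k=1..2*m. v (2*m + 1 - k) * w k)"
proof -
  have "(\<Sum>k=1..2*m. v (2*m + 1 - k) * w k) =
      (\<Sum>k=1..m. v (2*m + 1 - k) * w k) + (\<Sum>k=m+1..2*m. v (2*m + 1 - k) * w k)"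
    by (subst sum.union_disjoint[symmetric]) (auto intro!: sum.cong)
  also have "(\<Sum>k=m+1..2*m. v (2*m + 1 - k) * w k) = (\<Sum>k=1..m. v k * w (2*m + 1 - k))"
    by (rule sum.reindex_bij_witness[of _ "\<lambda>k. 2*m + 1 - k" "\<lambda>k. 2*m + 1 - k"]) auto
  finally show ?thesis by (simp add: bil_def sum.distrib)
qed

lemma quad_Const: "quad m (\<lambda>i. Const (v i)) = Const (quad m v)"
  by (simp add: quad_def Const_sum Const_mult)

lemma bil_Const: "bil m (\<lambda>i. Const (v i)) (\<lambda>i. Const (w i)) = Const (bil m v w)"
  by (simp add: bil_def Const_sum Const_mult Const_add)

lemma quad_form_quad: "quad_form m v = quad m (\<lambda>i. v $ (i - 1))"
  unfolding quad_form_def quad_def by simp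

definition unit_fun :: "nat \<Rightarrow> nat \<Rightarrow> 'b::comm_ring_1"
  where "unit_fun j i = (if i = j then 1 else 0)"

definition mat_col :: "'a mat \<Rightarrow> nat \<Rightarrow> nat \<Rightarrow> 'a"
  where "mat_col M j i = M $$ (i - 1, j - 1)"

lemma quad_unit_fun: "quad m (unit_fun j) = 0"
  unfolding quad_def unit_fun_def by (intro sum.neutral) auto

definition isometry :: "nat \<Rightarrow> 'a::field mat \<Rightarrow> bool"
  where "isometry m M \<longleftrightarrow> M \<in> carrier_mat (2*m) (2*m) \<and>
    (\<forall>v\<in>carrier_vec (2*m). quad_form m (M *\<^sub>v v) = quad_form m v)"

context
  fixes m :: nat and M :: "'a::field mat"
  assumes M: "isometry m M"
begin

lemma isometry_carrier: "M \<in> carrier_mat (2*m) (2*m)"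
  using M by (simp add: isometry_def)

lemma isometry_quad:
  assumes j: "j \<in> {1..2*m}"
  shows "quad m (mat_col M j) = 0"
proof -
  have "quad m (mat_col M j) = quad_form m (M *\<^sub>v unit_vec (2*m) (j - 1))"
    unfolding quad_form_quad using j isometry_carrier by (intro quad_cong) (auto simp: mat_col_def)
  also have "\<dots> = quad_form m (unit_vec (2*m) (j - 1))" using M by (simp add: isometry_def)
  also have "\<dots> = quad m (unit_fun j)"
    unfolding quad_form_quad using j by (intro quad_cong) (auto simp: unit_fun_def)
  finally show ?thesis by (simp add: quad_unit_fun)
qed

text \<open>Polarization: evaluate the quadratic form on the sum of two basis vectors.\<close>

lemma isometry_bil:
  assumes j: "j \<in> {1..2*m}" and l: "l \<in> {1..2*m}"
  shows "bil m (mat_col M j) (mat_col M l) = bil m (unit_fun j) (unit_fun l)"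
proof -
  define v where "v = unit_vec (2*m) (j - 1) + (unit_vec (2*m) (l - 1) :: 'a vec)"
  have "quad m (\<lambda>i. mat_col M j i + mat_col M l i) = quad_form m (M *\<^sub>v v)"
    unfolding quad_form_quad using j l isometry_carrier
    by (intro quad_cong) (auto simp: mat_col_def v_def mult_add_distrib_mat_vec[of _ "2*m" "2*m"])
  also have "\<dots> = quad_form m v" using M by (simp add: isometry_def v_def)
  also have "\<dots> = quad m (\<lambda>i. unit_fun j i + unit_fun l i)"
    unfolding quad_form_quad using j l by (intro quad_cong) (auto simp: unit_fun_def v_def)
  finally show ?thesis
    by (simp add: quad_add isometry_quad[OF j] isometry_quad[OF l] quad_unit_fun)
qed

end

text \<open>In column m, counted from 1, all entries above the diagonal vanish, so the form of this
  column is its entry in row m + 1 times the diagonal 1. This produces the block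
  \<open>1\<^sub>m 2\<close> in the centre and keeps x_m out of the orbit of x_{m+1}.\<close>

lemma unitri_isometry_middle:
  fixes M :: "'a::field mat"
  assumes "isometry m M" "M \<in> unitri (2*m)" "m \<ge> 1"
  shows "M $$ (m, m - 1) = 0"
proof -
  have "quad m (mat_col M m) = (\<Sum>i\<in>{m}. mat_col M m (2*m + 1 - i) * mat_col M m i)"
    unfolding quad_def using assms
    by (intro sum.mono_neutral_right) (auto simp: mat_col_def unitri_def)
  also have "\<dots> = M $$ (m, m - 1)" using assms by (simp add: mat_col_def unitri_def)
  finally show ?thesis using isometry_quad[OF assms(1), of m] assms(3) by simp
qed

lemma O_plus_isometry: "N \<in> O_plus m \<longleftrightarrow> isometry m N \<and> invertible_mat N"
  by (auto simp: O_plus_def isometry_def)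

lemma isometry_mat_inv:
  assumes "N \<in> O_plus m"
  shows "isometry m (mat_inv N)"
proof -
  have N: "N \<in> carrier_mat (2*m) (2*m)" "invertible_mat N" using assms by (auto simp: O_plus_def)
  note I = mat_inv[OF N]
  have "quad_form m (mat_inv N *\<^sub>v v) = quad_form m v" if v: "v \<in> carrier_vec (2*m)" for v
  proof -
    have "N *\<^sub>v (mat_inv N *\<^sub>v v) = v"
      using assoc_mult_mat_vec[OF N(1) I(1) v] I(3) v by simp
    moreover have "mat_inv N *\<^sub>v v \<in> carrier_vec (2*m)" using I(1) v by simp
    then have "quad_form m (N *\<^sub>v (mat_inv N *\<^sub>v v)) = quad_form m (mat_inv N *\<^sub>v v)"
      using assms by (auto simp: O_plus_def)
    ultimately show ?thesis by simp
  qed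
  then show ?thesis using I(1) by (simp add: isometry_def)
qed

section \<open>Unitriangular isometries are exactly the elements of the group\<close>

lemma mat_mult_index:
  assumes "A \<in> carrier_mat n k" "B \<in> carrier_mat k l" "i < n" "j < l"
  shows "(A * B) $$ (i, j) = (\<Sum>a<k. A $$ (i, a) * B $$ (a, j))"
  using assms by (auto simp: scalar_prod_def lessThan_atLeast0 intro!: sum.cong)

text \<open>Induct on the columns from the right: in entry (i, j) of the product with i <= j, terms
  left of j vanish by the shape of \<open>g\<close> and terms right of j by induction, which leaves
  M(i, j).\<close>

lemma unitri_left_inverse:
  assumes g: "g \<in> unitri n" and M: "M \<in> carrier_mat n n" "M * g = 1\<^sub>m n"
  shows "M \<in> unitri n"
proof -
  have g': "g \<in> carrier_mat n n" using g by (simp add: unitri_def)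
  have "M $$ (i, j) = (if i = j then 1 else 0)" if "i \<le> j" "i < n" "j < n" for i j
    using that(1,3)
  proof (induction "n - j" arbitrary: j rule: less_induct)
    case less
    have "(M * g) $$ (i, j) = (\<Sum>a<n. M $$ (i, a) * g $$ (a, j))"
      by (rule mat_mult_index[OF M(1) g']) (use less that in auto)
    also have "\<dots> = (\<Sum>a\<in>{j}. M $$ (i, a) * g $$ (a, j))"
    proof (intro sum.mono_neutral_right ballI)
      fix a assume "a \<in> {..<n} - {j}"
      then consider "a < j" | "j < a" "a < n" by force
      then show "M $$ (i, a) * g $$ (a, j) = 0"
      proof cases
        case 1
        then show ?thesis using g less.prems by (simp add: unitri_def)
      next
        case 2
        then show ?thesis using less by simp
      qed
    qed (use less in auto)
    finally show ?case using M g less.prems that by (simp add: unitri_def)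
  qed
  then show ?thesis using M by (auto simp: unitri_def)
qed

lemma transpose_antidiag_index:
  assumes "A \<in> carrier_mat n k" "B \<in> carrier_mat n l" "i < k" "j < l"
  shows "(transpose_mat A * antidiag n * B) $$ (i, j) = (\<Sum>a<n. A $$ (n - 1 - a, i) * B $$ (a, j))"
proof -
  have J: "antidiag n \<in> carrier_mat n n" by (simp add: antidiag_def)
  have 1: "(transpose_mat A * antidiag n) $$ (i, a) = A $$ (n - 1 - a, i)" if a: "a < n" for a
  proof -
    have "(transpose_mat A * antidiag n) $$ (i, a) =
        (\<Sum>b<n. transpose_mat A $$ (i, b) * antidiag n $$ (b, a))"
      by (rule mat_mult_index[OF transpose_carrier_mat[THEN iffD2, OF assms(1)] J]) (use assms a in auto)
    also have "\<dots> = (\<Sum>b<n. if b = n - 1 - a then A $$ (b, i) else 0)"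
      using assms a by (intro sum.cong) (auto simp: antidiag_def)
    finally show ?thesis using a by simp
  qed
  have "(transpose_mat A * antidiag n * B) $$ (i, j) =
      (\<Sum>a<n. (transpose_mat A * antidiag n) $$ (i, a) * B $$ (a, j))"
    by (rule mat_mult_index[OF mult_carrier_mat[OF transpose_carrier_mat[THEN iffD2, OF assms(1)] J]])
       (use assms in auto)
  then show ?thesis by (simp add: 1)
qed

lemma transpose_antidiag_bil:
  assumes M: "M \<in> carrier_mat (2*m) (2*m)" and kl: "k < 2*m" "l < 2*m"
  shows "(transpose_mat M * antidiag (2*m) * M) $$ (k, l) = bil m (mat_col M (Suc k)) (mat_col M (Suc l))"
proof -
  have "(\<Sum>a<2*m. M $$ (2*m - 1 - a, k) * M $$ (a, l)) =
      (\<Sum>a=1..2*m. mat_col M (Suc k) (2*m + 1 - a) * mat_col M (Suc l) a)"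
    by (rule sum.reindex_bij_witness[of _ "\<lambda>a. a - 1" Suc]) (auto simp: mat_col_def)
  then show ?thesis unfolding transpose_antidiag_index[OF M M kl] bil_alt .
qed

lemma isometry_gram:
  fixes M :: "'a::field mat"
  assumes M: "isometry m M"
  shows "transpose_mat M * antidiag (2*m) * M = antidiag (2*m)"
proof (rule eq_matI)
  note C = isometry_carrier[OF M]
  fix k l assume "k < dim_row (antidiag (2*m) :: 'a mat)" "l < dim_col (antidiag (2*m) :: 'a mat)"
  then have kl: "k < 2*m" "l < 2*m" by (simp_all add: antidiag_def)
  have "bil m (unit_fun (Suc k)) (unit_fun (Suc l)) =
      (\<Sum>a=1..2*m. if a = Suc l then if k + l + 1 = 2*m then 1 else 0 else (0::'a))"
    unfolding bil_alt by (intro sum.cong) (use kl in \<open>auto simp: unit_fun_def\<close>)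
  also have "\<dots> = antidiag (2*m) $$ (k, l)" using kl by (simp add: antidiag_def)
  finally show "(transpose_mat M * antidiag (2*m) * M) $$ (k, l) = antidiag (2*m) $$ (k, l)"
    using kl isometry_bil[OF M, of "Suc k" "Suc l"] by (simp add: transpose_antidiag_bil[OF C kl])
qed (use isometry_carrier[OF M] in \<open>auto simp: antidiag_def\<close>)

text \<open>All further conditions in \<open>G1\<close> are consequences of the form vanishing on
  the columns, so membership of the transvections reduces to checking that they are unitriangular
  isometries.\<close>

lemma unitri_O_plus_in_G1:
  fixes N :: "'a::field mat"
  assumes two: "(1::'a) + 1 = 0" and m: "m \<ge> 1" and N: "N \<in> O_plus m" "N \<in> unitri (2*m)"
  shows "N \<in> G1 m"
proof -
  define A where "A = mat (m - 1) (m - 1) (\<lambda>(a, b). N $$ (a, b))"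
  define B where "B = mat 2 (m - 1) (\<lambda>(a, b). N $$ (m - 1 + a, b))"
  define C where "C = mat (m - 1) (m - 1) (\<lambda>(a, b). N $$ (m + 1 + a, b))"
  define D where "D = mat (m - 1) 2 (\<lambda>(a, b). N $$ (m + 1 + a, m - 1 + b))"
  define E where "E = mat (m - 1) (m - 1) (\<lambda>(a, b). N $$ (m + 1 + a, m + 1 + b))"
  note defs = A_def B_def C_def D_def E_def
  have iso: "isometry m N" using N by (simp add: O_plus_isometry)
  have NC: "N \<in> carrier_mat (2*m) (2*m)" by (rule isometry_carrier[OF iso])
  have diag: "N $$ (i, i) = 1" if "i < 2*m" for i using N that by (simp add: unitri_def)
  have upper: "N $$ (i, j) = 0" if "i < j" "j < 2*m" for i j using N that by (simp add: unitri_def)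
  have mid: "N $$ (m, m - 1) = 0" by (rule unitri_isometry_middle[OF iso N(2) m])
  have block: "N = block_mat m A B C D E"
  proof (rule eq_matI)
    fix i j assume "i < dim_row (block_mat m A B C D E)" "j < dim_col (block_mat m A B C D E)"
    then have ij: "i < 2*m" "j < 2*m" using m by (simp_all add: block_mat_def defs)
    \<comment> \<open>On the central two rows and columns, the one entry not governed by
      unitriangularity is \<open>mid\<close>.\<close>
    have "N $$ (i, j) = (if i = j then 1 else 0)"
      if "i - (m - 1) < 2" "j - (m - 1) < 2" "i \<ge> m - 1" "j \<ge> m - 1"
    proof -
      have "i = m - 1 \<or> i = m" "j = m - 1 \<or> j = m" using that m by linarith+
      then show ?thesis using mid diag[OF ij(1)] upper[of i j] ij m by auto
    qed
    then show "N $$ (i, j) = block_mat m A B C D E $$ (i, j)"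
      using ij m upper[of i j] by (auto simp: block_mat_def defs)
  qed (use NC m in \<open>auto simp: block_mat_def defs\<close>)
  \<comment> \<open>In the form of column i + 1 the outer m - 1 index pairs contribute the diagonal
    entry of S and the central pair contributes the product of the two entries of B. Their sum is
    zero, and characteristic 2 removes the sign.\<close>
  have S: "(transpose_mat A * antidiag (m - 1) * C) $$ (i, i) = B $$ (0, i) * B $$ (1, i)" if i: "i < m - 1" for i
  proof -
    have "(transpose_mat A * antidiag (m - 1) * C) $$ (i, i) =
        (\<Sum>a<m-1. A $$ (m - 1 - 1 - a, i) * C $$ (a, i))"
      by (rule transpose_antidiag_index[of _ _ "m - 1" _ "m - 1"]) (use i in \<open>auto simp: defs\<close>)
    also have "\<dots> = (\<Sum>k=1..m-1. mat_col N (Suc i) (2*m + 1 - k) * mat_col N (Suc i) k)"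
      by (rule sum.reindex_bij_witness[of _ "\<lambda>k. m - 1 - k" "\<lambda>a. m - 1 - a"])
         (use i in \<open>auto simp: defs mat_col_def mult.commute\<close>)
    finally have "quad m (mat_col N (Suc i)) =
        (transpose_mat A * antidiag (m - 1) * C) $$ (i, i) + N $$ (m, i) * N $$ (m - 1, i)"
      unfolding quad_def using m by (cases m) (simp_all add: mat_col_def)
    moreover have "quad m (mat_col N (Suc i)) = 0"
      by (rule isometry_quad[OF iso]) (use i in auto)
    ultimately have "(transpose_mat A * antidiag (m - 1) * C) $$ (i, i) = - (N $$ (m, i) * N $$ (m - 1, i))"
      by (simp add: eq_neg_iff_add_eq_0)
    also have "\<dots> = N $$ (m, i) * N $$ (m - 1, i)"
      unfolding neg_eq_iff_add_eq_0 by (rule char_two[OF two])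
    also have "\<dots> = B $$ (0, i) * B $$ (1, i)" using i m by (simp add: B_def mult.commute)
    finally show ?thesis .
  qed
  have "A \<in> unitri (m - 1)" "E \<in> unitri (m - 1)"
    using diag upper m by (auto simp: unitri_def defs)
  moreover have "B \<in> carrier_mat 2 (m - 1)" "C \<in> carrier_mat (m - 1) (m - 1)" "D \<in> carrier_mat (m - 1) 2"
    by (simp_all add: defs)
  ultimately show ?thesis
    using N block S isometry_gram[OF iso] unfolding G1_def by blast
qed

section \<open>Transvections\<close>

text \<open>With \<open>i' = 2m + 1 - i\<close>, \<open>transv m i c\<close> acts by \<open>x\<^sub>i \<mapsto> x\<^sub>i + \<Sum>\<^sub>j c\<^sub>j x\<^sub>j\<close> and \<open>x\<^bsub>j'\<^esub> \<mapsto> x\<^bsub>j'\<^esub> + c\<^sub>j x\<^bsub>i'\<^esub>\<close>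
  for \<open>j < min(i, i')\<close>; in characteristic 2 the changes of \<open>x\<^sub>i x\<^bsub>i'\<^esub>\<close> and of the \<open>x\<^sub>j x\<^bsub>j'\<^esub>\<close> cancel.\<close>

definition transv_part :: "nat \<Rightarrow> nat \<Rightarrow> (nat \<Rightarrow> 'a) \<Rightarrow> 'a::field mat"
  where "transv_part m i c = mat (2*m) (2*m) (\<lambda>(a, b).
    (if a + 1 = i \<and> b + 1 < min i (2*m + 1 - i) then c (b + 1) else 0) +
    (if b + i = 2*m \<and> 2*m - a < min i (2*m + 1 - i) then c (2*m - a) else 0))"

definition transv :: "nat \<Rightarrow> nat \<Rightarrow> (nat \<Rightarrow> 'a) \<Rightarrow> 'a::field mat"
  where "transv m i c = 1\<^sub>m (2*m) + transv_part m i c"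

lemma transv_carrier: "transv_part m i c \<in> carrier_mat (2*m) (2*m)" "transv m i c \<in> carrier_mat (2*m) (2*m)"
  by (simp_all add: transv_def transv_part_def)

lemma transv_part_zero:
  assumes "a < 2*m" "b < 2*m" "\<not> (a + 1 = i \<and> b + 1 < min i (2*m + 1 - i))"
    "\<not> (b + i = 2*m \<and> 2*m - a < min i (2*m + 1 - i))"
  shows "transv_part m i c $$ (a, b) = 0"
  unfolding transv_part_def index_mat(1)[OF assms(1,2)] case_prod_conv
  by (simp only: assms(3,4) if_False add_0)

text \<open>With indices from 1, the condition \<open>b + i = 2*m\<close> singles out column i', and
  row k = j' carries the coefficient with index j = 2m + 1 - k.\<close>

lemma transv_part_index:
  assumes "k \<in> {1..2*m}" "j \<in> {1..2*m}" "i \<in> {1..2*m}"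
  shows "transv_part m i c $$ (k - 1, j - 1) =
    (if k = i \<and> j < min i (2*m + 1 - i) then c j else 0) +
    (if j = 2*m + 1 - i \<and> 2*m + 1 - k < min i (2*m + 1 - i) then c (2*m + 1 - k) else 0)"
proof -
  have lt: "k - 1 < 2*m" "j - 1 < 2*m" using assms by auto
  have eqs: "k - 1 + 1 = k" "j - 1 + 1 = j" "2*m - (k - 1) = 2*m + 1 - k"
    "(j - 1 + i = 2*m) = (j = 2*m + 1 - i)" using assms by auto
  show ?thesis unfolding transv_part_def index_mat(1)[OF lt] case_prod_conv eqs ..
qed

context
  fixes m i :: nat and c :: "nat \<Rightarrow> 'a::field"
  assumes two: "(1::'a) + 1 = 0" and i: "i \<in> {1..2*m}"
begin

text \<open>The added part N has nonzero columns only at the j < s and at i', and nonzero rows only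
  at i and at the j' with j < s. These index sets are disjoint, so N squares to zero and (1 + N)^2 =
  1 + 2N = 1.\<close>

lemma transv_involution: "transv m i c * transv m i c = 1\<^sub>m (2*m)"
proof -
  let ?N = "transv_part m i c"
  have NN: "?N * ?N = 0\<^sub>m (2*m) (2*m)"
  proof (rule eq_matI)
    fix a b assume "a < dim_row (0\<^sub>m (2*m) (2*m) :: 'a mat)" "b < dim_col (0\<^sub>m (2*m) (2*m) :: 'a mat)"
    then have ab: "a < 2*m" "b < 2*m" by simp_all
    have "?N $$ (a, k) * ?N $$ (k, b) = 0" if k: "k < 2*m" for k
    proof -
      define s where "s = min i (2*m + 1 - i)"
      have s: "s \<le> i" "s + i \<le> 2*m + 1" using i by (auto simp: s_def)
      have "\<not> (k + 1 < s \<and> k + 1 = i)" using s by linarith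
      moreover have "\<not> (k + 1 < s \<and> 2*m - k < s)" using s k by linarith
      \<comment> \<open>This is i = i', excluded by parity since i + i' is odd.\<close>
      moreover have "\<not> (k + i = 2*m \<and> k + 1 = i)" by presburger
      moreover have "\<not> (k + i = 2*m \<and> 2*m - k < s)" using s by linarith
      ultimately have "\<not> ((a + 1 = i \<and> k + 1 < s \<or> k + i = 2*m \<and> 2*m - a < s) \<and>
          (k + 1 = i \<and> b + 1 < s \<or> b + i = 2*m \<and> 2*m - k < s))"
        by blast
      moreover have "?N $$ (x, y) = 0" if "x < 2*m" "y < 2*m"
        "\<not> (x + 1 = i \<and> y + 1 < s \<or> y + i = 2*m \<and> 2*m - x < s)" for x y
        using that transv_part_zero[of x m y i c] unfolding s_def by blast
      ultimately show ?thesis using ab k by (metis mult_zero_left mult_zero_right)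
    qed
    then show "(?N * ?N) $$ (a, b) = 0\<^sub>m (2*m) (2*m) $$ (a, b)"
      using ab by (subst mat_mult_index[OF transv_carrier(1) transv_carrier(1)]) (auto intro!: sum.neutral)
  qed (simp_all add: transv_part_def)
  have "transv m i c * transv m i c = 1\<^sub>m (2*m) + ?N + (?N + ?N * ?N)"
  proof -
    note C = one_carrier_mat[of "2*m"] transv_carrier(1)[of m i c]
    have "transv m i c * transv m i c = 1\<^sub>m (2*m) * transv m i c + ?N * transv m i c"
      unfolding transv_def by (rule add_mult_distrib_mat[OF C add_carrier_mat[OF C(2)]])
    also have "?N * transv m i c = ?N * 1\<^sub>m (2*m) + ?N * ?N"
      unfolding transv_def by (rule mult_add_distrib_mat[OF C(2) C])
    finally show ?thesis using C by (simp add: transv_def)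
  qed
  also have "\<dots> = 1\<^sub>m (2*m)"
    unfolding NN using transv_carrier(1)[of m i c] by (intro eq_matI) (auto simp: add.assoc char_two[OF two])
  finally show ?thesis .
qed

lemma transv_unitri: "transv m i c \<in> unitri (2*m)"
proof -
  define s where "s = min i (2*m + 1 - i)"
  have s: "s \<le> i" by (simp add: s_def)
  have "transv_part m i c $$ (a, b) = 0" if ab: "a \<le> b" "b < 2*m" for a b
  proof -
    have "\<not> (a + 1 = i \<and> b + 1 < s)" "\<not> (b + i = 2*m \<and> 2*m - a < s)" using ab s by linarith+
    then show ?thesis using ab transv_part_zero[of a m b i c] unfolding s_def by linarith
  qed
  then show ?thesis
    using transv_carrier(1)[of m i c] by (auto simp: unitri_def transv_def)
qed

text \<open>The displacement \<open>w\<close> is supported on i and the j' with j < s. No index and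
  its partner both occur there, so \<open>quad m w = 0\<close>; the polar form of \<open>x\<close>
  and \<open>w\<close> is x_{i'} L taken twice, which is zero.\<close>

lemma transv_isometry: "isometry m (transv m i c)"
  unfolding isometry_def
proof (intro conjI ballI transv_carrier)
  fix v :: "'a vec" assume v: "v \<in> carrier_vec (2*m)"
  define s where "s = min i (2*m + 1 - i)"
  define x where "x k = v $ (k - 1)" for k
  define L where "L = (\<Sum>j=1..<s. c j * x j)"
  define w where "w k = (if k = i then L else 0) +
    (if 2*m + 1 - k < s then c (2*m + 1 - k) * x (2*m + 1 - i) else 0)" for k
  have E: "(transv_part m i c *\<^sub>v v) $ (k - 1) = w k" if k: "k \<in> {1..2*m}" for k
  proof -
    have "(transv_part m i c *\<^sub>v v) $ (k - 1) = (\<Sum>b<2*m. transv_part m i c $$ (k - 1, b) * v $ b)"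
      using k v transv_carrier(1)[of m i c] by (auto simp: scalar_prod_def lessThan_atLeast0 intro!: sum.cong)
    also have "\<dots> = (\<Sum>j=1..2*m. transv_part m i c $$ (k - 1, j - 1) * x j)"
      by (rule sum.reindex_bij_witness[of _ "\<lambda>j. j - 1" Suc]) (auto simp: x_def)
    also have "\<dots> = (\<Sum>j=1..2*m. (if k = i \<and> j < s then c j * x j else 0) +
        (if j = 2*m + 1 - i then (if 2*m + 1 - k < s then c (2*m + 1 - k) * x j else 0) else 0))"
    proof (intro sum.cong refl)
      fix j assume j: "j \<in> {1..2*m}"
      show "transv_part m i c $$ (k - 1, j - 1) * x j = (if k = i \<and> j < s then c j * x j else 0) +
          (if j = 2*m + 1 - i then (if 2*m + 1 - k < s then c (2*m + 1 - k) * x j else 0) else 0)"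
        unfolding transv_part_index[OF k j i] s_def by (simp only: distrib_right if_distribR) simp
    qed
    also have "\<dots> = (\<Sum>j=1..2*m. if k = i \<and> j < s then c j * x j else 0) +
        (if 2*m + 1 - k < s then c (2*m + 1 - k) * x (2*m + 1 - i) else 0)"
    proof -
      have "2*m + 1 - i \<in> {1..2*m}" using i by auto
      then show ?thesis by (simp only: sum.distrib sum.delta finite_atLeastAtMost if_True)
    qed
    also have "(\<Sum>j=1..2*m. if k = i \<and> j < s then c j * x j else 0) = (if k = i then L else 0)"
    proof (cases "k = i")
      case True
      have "(\<Sum>j=1..2*m. if j < s then c j * x j else 0) = (\<Sum>j\<in>{j\<in>{1..2*m}. j < s}. c j * x j)"
        by (rule sum.inter_filter[OF finite_atLeastAtMost, symmetric])
      also have "{j\<in>{1..2*m}. j < s} = {1..<s}" using i by (auto simp: s_def)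
      finally show ?thesis using True by (simp add: L_def)
    qed simp
    finally show ?thesis by (simp add: w_def)
  qed
  have "quad_form m (transv m i c *\<^sub>v v) = quad m (\<lambda>k. x k + w k)"
    unfolding quad_form_quad
  proof (rule quad_cong)
    fix k assume k: "k \<in> {1..2*m}"
    have "transv m i c *\<^sub>v v = v + transv_part m i c *\<^sub>v v"
      using v transv_carrier(1)[of m i c] by (simp add: transv_def add_mult_distrib_mat_vec[of _ "2*m" "2*m"])
    then show "(transv m i c *\<^sub>v v) $ (k - 1) = x k + w k"
      using E[OF k] k transv_carrier(1)[of m i c] by (auto simp: x_def)
  qed
  also have "\<dots> = quad m x"
  proof -
    have "quad m w = 0"
      unfolding quad_def
    proof (intro sum.neutral ballI)
      fix k assume k: "k \<in> {1..m}"
      show "w (2*m + 1 - k) * w k = 0"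
      proof (cases "k = i")
        case True
        then have "2*m + 1 - k \<noteq> i" "\<not> 2*m + 1 - (2*m + 1 - k) < s" using k by (auto simp: s_def)
        then show ?thesis by (simp only: w_def if_False add_0 mult_zero_left)
      next
        case False
        then have "\<not> 2*m + 1 - k < s" using k i by (auto simp: s_def)
        then show ?thesis using False by (simp only: w_def if_False add_0 mult_zero_right)
      qed
    qed
    moreover have "bil m x w = 0"
    proof -
      have "bil m x w = (\<Sum>k=1..2*m. if k = i then x (2*m + 1 - i) * L else 0) +
          (\<Sum>k=1..2*m. if 2*m + 1 - k < s then x (2*m + 1 - k) * (c (2*m + 1 - k) * x (2*m + 1 - i)) else 0)"
        unfolding bil_alt w_def by (subst sum.distrib[symmetric]) (auto intro!: sum.cong simp: distrib_left)
      also have "(\<Sum>k=1..2*m. if 2*m + 1 - k < s then x (2*m + 1 - k) * (c (2*m + 1 - k) * x (2*m + 1 - i)) else 0)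
          = (\<Sum>j=1..2*m. if j < s then x j * (c j * x (2*m + 1 - i)) else 0)"
        by (rule sum.reindex_bij_witness[of _ "\<lambda>k. 2*m + 1 - k" "\<lambda>k. 2*m + 1 - k"]) auto
      also have "\<dots> = (\<Sum>j\<in>{j\<in>{1..2*m}. j < s}. x j * (c j * x (2*m + 1 - i)))"
        by (rule sum.inter_filter[OF finite_atLeastAtMost, symmetric])
      also have "{j\<in>{1..2*m}. j < s} = {1..<s}" using i by (auto simp: s_def)
      also have "(\<Sum>j=1..<s. x j * (c j * x (2*m + 1 - i))) = x (2*m + 1 - i) * L"
        by (simp add: L_def sum_distrib_left mult_ac)
      finally show ?thesis using i by (simp add: char_two[OF two])
    qed
    ultimately show ?thesis by (simp add: quad_add)
  qed
  also have "\<dots> = quad_form m v" unfolding quad_form_quad x_def[abs_def] ..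
  finally show "quad_form m (transv m i c *\<^sub>v v) = quad_form m v" .
qed

lemma transv_O_plus: "transv m i c \<in> O_plus m"
  using transv_isometry transv_involution transv_carrier(2)[of m i c]
  by (auto simp: O_plus_isometry invertible_mat_def inverts_mat_def)

lemma transv_G1: "transv m i c \<in> G1 m"
  using i by (intro unitri_O_plus_in_G1 two transv_O_plus transv_unitri) auto

text \<open>The action is defined by rows of the inverse; for an involution it can be read off the
  matrix itself.\<close>

lemma mat_inv_transv: "mat_inv (transv m i c) = transv m i c"
proof -
  let ?E = "transv m i c"
  have E: "?E \<in> carrier_mat (2*m) (2*m)" "invertible_mat ?E"
    using transv_O_plus by (auto simp: O_plus_def)
  note I = mat_inv[OF E]
  have "mat_inv ?E = mat_inv ?E * (?E * ?E)" using I(1) by (simp add: transv_involution)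
  also have "\<dots> = (mat_inv ?E * ?E) * ?E" by (rule assoc_mult_mat[OF I(1) E(1) E(1), symmetric])
  finally show ?thesis using I(2) E by simp
qed

text \<open>Apart from x_i only the x_{j'} with j < s move, and j < i' means j' > i. Hence
  everything adjoined before x_i stays fixed.\<close>

lemma act_var_transv:
  "act_var (transv m i c) i = Var i + lin_form {1..<min i (2*m + 1 - i)} c"
  "k \<in> {1..<i} \<Longrightarrow> act_var (transv m i c) k = Var k"
proof -
  have dim: "dim_row (transv m i c) = 2*m" using transv_carrier(2)[of m i c] by auto
  have A: "act_var (transv m i c) k = (\<Sum>j=1..2*m. if j = k then Var j else 0) +
      (\<Sum>j=1..2*m. Const (transv_part m i c $$ (k - 1, j - 1)) * Var j)" if k: "k \<in> {1..2*m}" for k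
  proof -
    have "transv m i c $$ (k - 1, j - 1) = (if j = k then 1 else 0) + transv_part m i c $$ (k - 1, j - 1)"
      if j: "j \<in> {1..2*m}" for j
    proof -
      have "k - 1 < 2*m" "j - 1 < 2*m" "(k - 1 = j - 1) = (j = k)" using j k by auto
      then show ?thesis using transv_carrier(1)[of m i c] by (simp add: transv_def)
    qed
    then show ?thesis
      unfolding act_var_def mat_inv_transv dim
      by (subst sum.distrib[symmetric], intro sum.cong) (simp_all add: Const_add Const_0 Const_1 distrib_right)
  qed
  have "(\<Sum>j=1..2*m. Const (transv_part m i c $$ (i - 1, j - 1)) * Var j) =
      lin_form {1..<min i (2*m + 1 - i)} c"
    unfolding lin_form_def
  proof (rule sum.mono_neutral_cong_right)
    show "\<forall>j\<in>{1..2*m} - {1..<min i (2*m + 1 - i)}. Const (transv_part m i c $$ (i - 1, j - 1)) * Var j = 0"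
    proof
      fix j assume j: "j \<in> {1..2*m} - {1..<min i (2*m + 1 - i)}"
      then have "\<not> j < min i (2*m + 1 - i)" "\<not> 2*m + 1 - i < min i (2*m + 1 - i)" "j \<in> {1..2*m}" by auto
      then show "Const (transv_part m i c $$ (i - 1, j - 1)) * Var j = 0"
        using transv_part_index[OF i _ i, of j c] by (simp only: if_False Const_0 add_0 simp_thms mult_zero_left)
    qed
  next
    fix j assume j: "j \<in> {1..<min i (2*m + 1 - i)}"
    then have "j \<in> {1..2*m}" "j < min i (2*m + 1 - i)" "\<not> 2*m + 1 - i < min i (2*m + 1 - i)" using i by auto
    then show "Const (transv_part m i c $$ (i - 1, j - 1)) * Var j = Const (c j) * Var j"
      using transv_part_index[OF i _ i, of j c] by (simp only: if_True if_False simp_thms add_0_right)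
  qed (use i in auto)
  then show "act_var (transv m i c) i = Var i + lin_form {1..<min i (2*m + 1 - i)} c"
    using A[OF i] i by simp
  assume k: "k \<in> {1..<i}"
  have "(\<Sum>j=1..2*m. Const (transv_part m i c $$ (k - 1, j - 1)) * Var j) = 0"
  proof (intro sum.neutral ballI)
    fix j assume j: "j \<in> {1..2*m}"
    have "k \<in> {1..2*m}" "k \<noteq> i" "\<not> 2*m + 1 - k < min i (2*m + 1 - i)" using i k by auto
    then show "Const (transv_part m i c $$ (k - 1, j - 1)) * Var j = 0"
      using transv_part_index[OF _ j i, of k c] by (simp only: if_False Const_0 add_0 simp_thms mult_zero_left)
  qed
  then show "act_var (transv m i c) k = Var k"
    using A[of k] i k by simp
qed

end

section \<open>The action on polynomials and rational functions\<close>

lemma act_poly_Var: "act_poly g (Var i) = act_var g i"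
  by (simp add: act_poly_def subst_Var)

lemmas act_poly_simps = act_poly_def subst_add subst_mult subst_sum subst_prod subst_power subst_Const subst_Var

lemma act_poly_quad: "act_poly g (quad m v) = quad m (\<lambda>i. act_poly g (v i))"
  by (simp add: quad_def act_poly_simps)

lemma act_poly_bil: "act_poly g (bil m v w) = bil m (\<lambda>i. act_poly g (v i)) (\<lambda>i. act_poly g (w i))"
  by (simp add: bil_def act_poly_simps)

text \<open>On the right the variables come first: they play the scalars and the constants play the
  vectors when \<open>bil_scaled_sum\<close> is applied.\<close>

lemma pol_frobenius_linear:
  fixes d :: "nat \<Rightarrow> 'a::{finite,field}"
  assumes q: "q = card (UNIV :: 'a set)" "q = 2 ^ r"
  shows "(\<Sum>j\<in>A. Const (d j) * Var j) ^ (q ^ k) = (\<Sum>j\<in>A. Var j ^ (q ^ k) * Const (d j))"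
proof -
  have two: "(1::'a) + 1 = 0" using two_eq_zero_finite_field[where ?'a = 'a] q by metis
  have two': "(1::'a pol) + 1 = 0"
    using arg_cong[OF two, of Const] by (simp only: Const_add Const_1 Const_0)
  have const: "Const a ^ (q ^ k) = Const a" for a :: 'a
  proof -
    have "a ^ (q ^ k) = a"
      by (induction k) (simp_all add: power_mult q(1) finite_field_power_card_eq)
    then show ?thesis by (simp flip: Const_power)
  qed
  have "(\<Sum>j\<in>A. Const (d j) * Var j) ^ (q ^ k) = (\<Sum>j\<in>A. (Const (d j) * Var j) ^ (q ^ k))"
    unfolding q(2) power_mult[symmetric] by (rule freshmans_dream_two_sum[OF two'])
  then show ?thesis by (simp add: power_mult_distrib const mult.commute)
qed

text \<open>Presents the untransformed variables in the same shape as the transformed ones, with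
  \<open>unit_fun\<close> in place of matrix columns.\<close>

lemma Var_expand:
  assumes "i \<in> {1..2*m}"
  shows "(Var i :: 'a::field pol) = (\<Sum>j=1..2*m. Const (unit_fun j i) * Var j)"
proof -
  have "(\<Sum>j=1..2*m. Const (unit_fun j i) * Var j :: 'a pol) = (\<Sum>j=1..2*m. if i = j then Var j else 0)"
    by (intro sum.cong) (simp_all add: unit_fun_def Const_0 Const_1)
  then show ?thesis using assms by simp
qed

text \<open>Expanded in the variables, the transformed polynomial depends on the matrix only through
  the values of the quadratic and polar forms on its columns. An isometry gives these the same
  values as the identity matrix.\<close>

lemma h_pol_invariant:
  fixes g :: "'a::{finite,field} mat"
  assumes q: "q = card (UNIV :: 'a set)" "q = 2 ^ r" and g: "g \<in> O_plus m" and k: "k \<ge> 1"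
  shows "act_poly g (h_pol m q k) = h_pol m q k"
proof -
  define M where "M = mat_inv g"
  have M: "isometry m M" unfolding M_def by (rule isometry_mat_inv[OF g])
  have dim: "dim_row g = 2*m" using g by (auto simp: O_plus_def)
  have act: "act_var g i = (\<Sum>j=1..2*m. Const (mat_col M j i) * Var j)" for i
    by (simp add: act_var_def dim M_def mat_col_def)
  have lin: "(\<Sum>j=1..2*m. Const (d j) * Var j) = (\<Sum>j=1..2*m. Var j * Const (d j))" for d :: "nat \<Rightarrow> 'a"
    by (simp add: mult.commute)
  show ?thesis
  proof (cases "k = 1")
    case True
    have *: "quad m (\<lambda>i. \<Sum>j=1..2*m. Const (d j i) * Var j) =
        (\<Sum>j=1..2*m. Var j ^ 2 * Const (quad m (d j))) +
        (\<Sum>l=1..2*m. \<Sum>j\<in>{j\<in>{1..2*m}. j < l}. Var j * Var l * Const (bil m (d j) (d l)))"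
      for d :: "nat \<Rightarrow> nat \<Rightarrow> 'a"
      unfolding lin by (simp add: quad_scaled_sum quad_Const bil_Const)
    have "quad m (act_var g) = quad m (\<lambda>i. \<Sum>j=1..2*m. Const (unit_fun j i) * Var j :: 'a pol)"
      unfolding act * by (intro arg_cong2[where f = "(+)"] sum.cong refl)
        (simp_all add: isometry_quad[OF M] isometry_bil[OF M] quad_unit_fun)
    also have "\<dots> = quad m Var" by (rule quad_cong) (simp only: Var_expand[symmetric])
    finally show ?thesis unfolding True h_pol_1 by (simp add: act_poly_quad act_poly_Var)
  next
    case False
    then obtain b where b: "k = Suc b" "b > 0" using k by (cases k) auto
    have *: "bil m (\<lambda>i. (\<Sum>j=1..2*m. Const (d j i) * Var j) ^ (q ^ b)) (\<lambda>i. \<Sum>j=1..2*m. Const (d j i) * Var j) =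
        (\<Sum>j=1..2*m. \<Sum>l=1..2*m. Var j ^ (q ^ b) * Var l * Const (bil m (d j) (d l)))"
      for d :: "nat \<Rightarrow> nat \<Rightarrow> 'a"
      unfolding pol_frobenius_linear[OF q] unfolding lin by (simp only: bil_scaled_sum bil_Const)
    have "bil m (\<lambda>i. act_var g i ^ (q ^ b)) (act_var g) =
        bil m (\<lambda>i. (\<Sum>j=1..2*m. Const (unit_fun j i) * Var j :: 'a pol) ^ (q ^ b))
          (\<lambda>i. \<Sum>j=1..2*m. Const (unit_fun j i) * Var j)"
      unfolding act * by (intro sum.cong refl) (simp add: isometry_bil[OF M])
    also have "\<dots> = bil m (\<lambda>i. Var i ^ q ^ b) Var"
      by (rule bil_cong) (simp_all only: Var_expand[symmetric])
    finally show ?thesis unfolding b(1) h_pol_Suc[OF b(2)]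
      by (simp add: act_poly_bil act_poly_Var) (simp add: act_poly_def subst_power subst_Var)
  qed
qed

section \<open>The orbits of x_1, ..., x_{m+1}\<close>

lemma lin_span_mono: "s \<le> t \<Longrightarrow> lin_span s \<subseteq> lin_span t"
proof
  fix u :: "'a pol" assume st: "s \<le> t" and "u \<in> lin_span s"
  then obtain c where "u = lin_form {1..<s} c" by (auto simp: lin_span_def)
  then show "u \<in> lin_span t"
    using st by (auto simp: lin_form_def intro!: lin_span_sum lin_span_scale Var_in_lin_span)
qed

text \<open>The coefficients form a row of the inverse, again a unitriangular isometry, so only x_j
  with j < i can be added to x_i.\<close>

lemma act_var_translate:
  assumes g: "g \<in> O_plus m" "g \<in> unitri (2*m)" and i: "i \<in> {1..m+1}" "i \<le> 2*m"
  shows "\<exists>u\<in>lin_span (min i (2*m + 1 - i)). act_var g i = Var i + u"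
proof -
  define M where "M = mat_inv g"
  have iso: "isometry m M" unfolding M_def by (rule isometry_mat_inv[OF g(1)])
  have gC: "g \<in> carrier_mat (2*m) (2*m)" "invertible_mat g" using g by (auto simp: O_plus_def)
  have M: "M \<in> unitri (2*m)"
    unfolding M_def by (rule unitri_left_inverse[OF g(2)]) (use mat_inv[OF gC] in auto)
  have mid: "M $$ (m, m - 1) = 0" by (rule unitri_isometry_middle[OF iso M]) (use i in auto)
  define s where "s = min i (2*m + 1 - i)"
  have "act_var g i = (\<Sum>j=1..2*m. Const (M $$ (i - 1, j - 1)) * Var j)"
    using gC by (simp add: act_var_def M_def)
  also have "\<dots> = (\<Sum>j\<in>insert i {1..<s}. Const (M $$ (i - 1, j - 1)) * Var j)"
  proof (intro sum.mono_neutral_right ballI)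
    fix j assume j: "j \<in> {1..2*m} - insert i {1..<s}"
    \<comment> \<open>Within this range min(i, i') falls below i only at i = m + 1, where the excess
      entry is the central one, which vanishes.\<close>
    then consider "j > i" | "i = m + 1" "j = m" using i by (force simp: s_def)
    then show "Const (M $$ (i - 1, j - 1)) * Var j = 0"
      by cases (use M j i mid in \<open>auto simp: unitri_def Const_0\<close>)
  qed (use i in \<open>auto simp: s_def\<close>)
  also have "\<dots> = Var i + lin_form {1..<s} (\<lambda>j. M $$ (i - 1, j - 1))"
  proof -
    have "M $$ (i - 1, i - 1) = 1" using M i by (auto simp: unitri_def)
    then show ?thesis by (simp add: s_def lin_form_def Const_1)
  qed
  finally show ?thesis unfolding lin_span_def s_def by blast
qed

lemma act_poly_lin_span:
  assumes g: "g \<in> O_plus m" "g \<in> unitri (2*m)" and s: "s \<le> m" and u: "u \<in> lin_span s"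
  shows "act_poly g u \<in> lin_span s"
proof -
  have "act_var g j \<in> lin_span s" if j: "j \<in> {1..<s}" for j
  proof -
    obtain v where v: "v \<in> lin_span (min j (2*m + 1 - j))" "act_var g j = Var j + v"
      using act_var_translate[OF g, of j] j s by auto
    have "min j (2*m + 1 - j) \<le> s" using j by auto
    then have "v \<in> lin_span s" using v(1) lin_span_mono by blast
    then show ?thesis unfolding v(2) by (intro lin_span_add Var_in_lin_span j)
  qed
  moreover obtain c where "u = lin_form {1..<s} c" using u unfolding lin_span_def by blast
  then have "act_poly g u = (\<Sum>j=1..<s. Const (c j) * act_var g j)"
    by (simp add: lin_form_def act_poly_simps)
  ultimately show ?thesis by (simp only: lin_span_sum lin_span_scale)
qed

text \<open>Rows of a unitriangular isometry give one inclusion; transvections, whose coefficients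
  are arbitrary, give the other.\<close>

lemma orbit_eq:
  assumes two: "(1::'a::field) + 1 = 0" and i: "i \<in> {1..m+1}" "i \<le> 2*m"
  shows "(\<lambda>g. act_poly g (Var i)) ` (G1 m :: 'a mat set) = (\<lambda>u. Var i + u) ` lin_span (min i (2*m + 1 - i))"
proof (intro equalityI subsetI)
  fix x assume "x \<in> (\<lambda>g. act_poly g (Var i)) ` (G1 m :: 'a mat set)"
  then obtain g :: "'a mat" where "g \<in> G1 m" "x = act_poly g (Var i)" by blast
  then show "x \<in> (\<lambda>u. Var i + u) ` lin_span (min i (2*m + 1 - i))"
    using act_var_translate[of g m i] i by (auto simp: G1_def act_poly_Var)
next
  fix x :: "'a pol" assume "x \<in> (\<lambda>u. Var i + u) ` lin_span (min i (2*m + 1 - i))"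
  then obtain c where "x = Var i + lin_form {1..<min i (2*m + 1 - i)} c" by (auto simp: lin_span_def)
  then have "x = act_poly (transv m i c) (Var i)"
    using act_var_transv(1)[OF two, of i m c] i by (simp add: act_poly_Var)
  then show "x \<in> (\<lambda>g. act_poly g (Var i)) ` (G1 m :: 'a mat set)"
    using transv_G1[OF two, of i m c] i by auto
qed

lemma emb_orbit_product:
  assumes two: "(1::'a::{finite,field}) + 1 = 0" and i: "i \<in> {1..m+1}" "i \<le> 2*m"
  shows "emb (orbit_product (G1 m :: 'a mat set) i) = span_prod (min i (2*m + 1 - i)) (emb (Var i))"
  unfolding orbit_product_def orbit_eq[OF assms] span_prod_def
  by (subst prod.reindex) (auto simp: emb_prod emb_add inj_on_def)

section \<open>Polynomials and rational functions in finitely many variables\<close>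

lemma polys_Const: "Const c \<in> polys n"
  by (auto simp: polys_def Const_def)

lemma polys_Var: "i \<in> {1..n} \<Longrightarrow> Var i \<in> polys n"
  by (auto simp: polys_def Var_def)

lemma polys_add: "x \<in> polys n \<Longrightarrow> y \<in> polys n \<Longrightarrow> x + y \<in> polys n"
  using Poly_Mapping.keys_add[of x y] unfolding polys_def by blast

lemma polys_mult: "x \<in> polys n \<Longrightarrow> y \<in> polys n \<Longrightarrow> x * y \<in> polys n"
proof -
  assume xy: "x \<in> polys n" "y \<in> polys n"
  have "Poly_Mapping.keys t \<subseteq> {1..n}" if "t \<in> Poly_Mapping.keys (x * y)" for t
  proof -
    obtain a b where "t = a + b" "a \<in> Poly_Mapping.keys x" "b \<in> Poly_Mapping.keys y"
      using \<open>t \<in> _\<close> Poly_Mapping.keys_mult[of x y] by blast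
    then show ?thesis using xy Poly_Mapping.keys_add[of a b] unfolding polys_def by blast
  qed
  then show ?thesis by (simp add: polys_def)
qed

lemma polys_uminus: "x \<in> polys n \<Longrightarrow> - x \<in> polys n"
  by (simp add: polys_def)

lemma polys_zero: "0 \<in> polys n"
  by (simp add: polys_def)

lemma polys_sum: "(\<And>i. i \<in> A \<Longrightarrow> f i \<in> polys n) \<Longrightarrow> sum f A \<in> polys n"
  by (induction A rule: infinite_finite_induct) (auto intro: polys_add polys_zero)

lemma polys_one: "1 \<in> polys n"
  using polys_Const[of 1] by (simp add: Const_1)

lemma polys_prod: "(\<And>i. i \<in> A \<Longrightarrow> f i \<in> polys n) \<Longrightarrow> prod f A \<in> polys n"
  by (induction A rule: infinite_finite_induct) (auto intro: polys_mult polys_one)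

lemma polys_power: "x \<in> polys n \<Longrightarrow> x ^ k \<in> polys n"
  by (induction k) (auto intro: polys_mult polys_one)

lemma Fract_in_rat_funs: "p \<in> polys n \<Longrightarrow> d \<in> polys n \<Longrightarrow> d \<noteq> 0 \<Longrightarrow> Fract p d \<in> rat_funs n"
  unfolding rat_funs_def by blast

lemma emb_in_rat_funs: "p \<in> polys n \<Longrightarrow> emb p \<in> rat_funs n"
  unfolding emb_def by (rule Fract_in_rat_funs) (simp_all add: polys_one)

lemma rat_funsE:
  assumes "x \<in> rat_funs n"
  obtains p d where "x = Fract p d" "p \<in> polys n" "d \<in> polys n" "d \<noteq> 0"
  using assms unfolding rat_funs_def by blast

lemma subfield_rat_funs: "subfield_set (rat_funs n)"
  unfolding subfield_set_def
proof (intro conjI ballI)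
  show "1 \<in> rat_funs n" using emb_in_rat_funs[OF polys_one] by (simp add: emb_1)
next
  fix x y :: "'a pol fract" assume "x \<in> rat_funs n" "y \<in> rat_funs n"
  then obtain p d p' d' where "x = Fract p d" "p \<in> polys n" "d \<in> polys n" "d \<noteq> 0"
    "y = Fract p' d'" "p' \<in> polys n" "d' \<in> polys n" "d' \<noteq> 0"
    by (metis rat_funsE)
  then show "x - y \<in> rat_funs n" "x * y \<in> rat_funs n"
    by (auto intro!: Fract_in_rat_funs polys_add polys_mult polys_uminus simp: diff_conv_add_uminus simp del: add_uminus_conv_diff)
next
  fix x :: "'a pol fract" assume x: "x \<in> rat_funs n"
  then obtain p d where *: "x = Fract p d" "p \<in> polys n" "d \<in> polys n" "d \<noteq> 0" by (rule rat_funsE)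
  show "inverse x \<in> rat_funs n"
  proof (cases "p = 0")
    case True
    then have "x = 0" using * by (simp add: Zero_fract_def eq_fract)
    then show ?thesis using x by simp
  next
    case False
    then show ?thesis using * by (auto intro!: Fract_in_rat_funs)
  qed
qed

lemma rat_funs_subset:
  fixes K :: "'a::field pol fract set"
  assumes K: "subfield_set K" and gens: "\<And>c. emb (Const c) \<in> K" "\<And>i. i \<in> {1..n} \<Longrightarrow> emb (Var i) \<in> K"
  shows "rat_funs n \<subseteq> K"
proof
  have *: "emb p \<in> K" if p: "p \<in> polys n" for p
  proof -
    have "emb p = emb (subst Var p)" by (simp only: subst_Var_id)
    also have "\<dots> \<in> K"
      unfolding subst_def emb_sum emb_mult emb_prod emb_power
    proof (intro subfield_intros[OF K] gens)
      fix t i assume "t \<in> Poly_Mapping.keys p" "i \<in> Poly_Mapping.keys t"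
      then show "i \<in> {1..n}" using p unfolding polys_def by blast
    qed
    finally show ?thesis .
  qed
  fix x :: "'a pol fract" assume "x \<in> rat_funs n"
  then obtain p d where x: "x = Fract p d" "p \<in> polys n" "d \<in> polys n" "d \<noteq> 0" by (rule rat_funsE)
  then have "x = emb p / emb d" by (simp add: emb_def)
  then show "x \<in> K" using subfield_divide[OF K *[OF x(2)] *[OF x(3)]] by simp
qed

context
  fixes g :: "'a::field mat" and n :: nat
  assumes g: "g \<in> carrier_mat n n" "invertible_mat g"
begin

lemma act_fract_emb: "p \<in> polys n \<Longrightarrow> act_fract g (emb p) = emb (act_poly g p)"
  unfolding emb_def using act_fract_Fract[OF g _ polys_one]
  by (simp add: act_poly_def subst_1)

lemma act_fract_hom_on: "hom_on (rat_funs n) (act_fract g)"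
  unfolding hom_on_def
proof (intro conjI ballI)
  show "act_fract g 1 = 1"
    using act_fract_emb[OF polys_one] by (simp add: emb_1 act_poly_def subst_1)
next
  fix x y :: "'a pol fract" assume "x \<in> rat_funs n" "y \<in> rat_funs n"
  then obtain p d p' d' where *: "x = Fract p d" "p \<in> polys n" "d \<in> polys n" "d \<noteq> 0"
    "y = Fract p' d'" "p' \<in> polys n" "d' \<in> polys n" "d' \<noteq> 0"
    by (metis rat_funsE)
  then have nz: "act_poly g d \<noteq> 0" "act_poly g d' \<noteq> 0" using act_poly_inj[OF g] by blast+
  have diff: "p * d' - p' * d \<in> polys n"
    using polys_add[OF polys_mult polys_uminus[OF polys_mult], of p n d' p' d] * by simp
  have act_diff: "act_poly g (a - b) = act_poly g a - act_poly g b" for a b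
    using subst_add[of "act_var g" "a - b" b] by (simp add: act_poly_def)
  have dd: "d * d' \<in> polys n" "d * d' \<noteq> 0" "p * p' \<in> polys n" using * by (simp_all add: polys_mult)
  show "act_fract g (x - y) = act_fract g x - act_fract g y"
    using * nz diff dd by (simp add: act_fract_Fract[OF g] act_diff act_poly_mult)
  show "act_fract g (x * y) = act_fract g x * act_fract g y"
    using * nz dd by (simp add: act_fract_Fract[OF g] act_poly_mult)
qed

end

text \<open>The orbit is the coset of \<open>lin_span s\<close> through \<open>Var i\<close>; a
  group element maps this finite set injectively into itself and so permutes the factors.\<close>

lemma orbit_product_invariant:
  fixes g :: "'a::{finite,field} mat"
  assumes two: "(1::'a) + 1 = 0" and i: "i \<in> {1..m+1}" "i \<le> 2*m" and g: "g \<in> G1 m"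
  shows "act_poly g (orbit_product (G1 m) i) = orbit_product (G1 m) i"
proof -
  define s where "s = min i (2*m + 1 - i)"
  define A :: "'a pol set" where "A = (\<lambda>u. Var i + u) ` lin_span s"
  have g': "g \<in> O_plus m" "g \<in> unitri (2*m)" using g by (auto simp: G1_def)
  have gC: "g \<in> carrier_mat (2*m) (2*m)" "invertible_mat g" using g' by (auto simp: O_plus_def)
  have sm: "s \<le> m" using i by (auto simp: s_def)
  have polysA: "x \<in> polys (2*m)" if "x \<in> A" for x
    using that i sm by (auto simp: A_def lin_span_def lin_form_def
        intro!: polys_add polys_sum polys_mult polys_Const polys_Var)
  obtain v where v: "v \<in> lin_span s" "act_var g i = Var i + v"
    using act_var_translate[OF g' i] unfolding s_def by blast
  have "act_poly g ` A \<subseteq> A"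
  proof
    fix x assume "x \<in> act_poly g ` A"
    then obtain u where u: "u \<in> lin_span s" "x = act_poly g (Var i + u)" by (auto simp: A_def)
    then have "x = Var i + (v + act_poly g u)" by (simp add: act_poly_simps v add.assoc)
    then show "x \<in> A" using v(1) act_poly_lin_span[OF g' sm u(1)] by (auto simp: A_def intro: lin_span_add)
  qed
  moreover have inj: "inj_on (act_poly g) A"
  proof (rule inj_onI)
    fix x y assume xy: "x \<in> A" "y \<in> A" "act_poly g x = act_poly g y"
    have "x - y \<in> polys (2*m)"
      using polys_add[OF polysA polys_uminus[OF polysA], of x y] xy by simp
    moreover have "act_poly g (x - y) = 0"
      using subst_add[of "act_var g" "x - y" y] xy(3) by (simp add: act_poly_def)
    ultimately have "x - y = 0" by (rule act_poly_inj[OF gC])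
    then show "x = y" by simp
  qed
  moreover have "finite A" by (simp add: A_def finite_lin_span)
  ultimately have "act_poly g ` A = A" by (rule endo_inj_surj[rotated])
  then have "(\<Prod>y\<in>A. act_poly g y) = \<Prod>A"
    using prod.reindex[OF inj, of "\<lambda>y. y"] by simp
  then show ?thesis
    unfolding orbit_product_def orbit_eq[OF two i] s_def[symmetric] A_def[symmetric]
    by (simp add: act_poly_def subst_prod)
qed

section \<open>The tower of fields\<close>

primrec tower :: "'a::field pol fract set \<Rightarrow> nat \<Rightarrow> 'a pol fract set"
  where "tower K 0 = K"
  | "tower K (Suc i) = simple_ext (tower K i) (emb (Var (Suc i)))"

context
  fixes K :: "'a::field pol fract set"
  assumes K: "subfield_set K"
begin

lemma subfield_tower: "subfield_set (tower K i)"
  by (induction i) (simp_all add: K subfield_simple_ext)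

lemma tower_base: "K \<subseteq> tower K i"
  by (induction i) (use subfield_simple_ext(2)[OF subfield_tower] in auto)

lemma tower_Var: "j \<in> {1..i} \<Longrightarrow> emb (Var j) \<in> tower K i"
proof (induction i)
  case (Suc i)
  then show ?case
    using subfield_simple_ext(2,3)[OF subfield_tower] by (cases "j = Suc i") auto
qed simp

lemma tower_subset:
  assumes "subfield_set R" "K \<subseteq> R" "\<And>j. j \<in> {1..i} \<Longrightarrow> emb (Var j) \<in> R"
  shows "tower K i \<subseteq> R"
  using assms(3)
proof (induction i)
  case (Suc i)
  then have "tower K i \<subseteq> R" "emb (Var (Suc i)) \<in> R" by auto
  then show ?case unfolding tower.simps by (rule simple_ext_subset[OF subfield_tower assms(1)])
qed (use assms in simp)

end

lemma span_prod_eq_0: "T \<in> emb ` lin_span s \<Longrightarrow> span_prod s T = 0"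
proof -
  assume "T \<in> emb ` lin_span s"
  then obtain u where u: "u \<in> lin_span s" "T = emb u" by blast
  have "- u \<in> lin_span s" using lin_span_scale[OF u(1), of "- 1"] by (simp add: Const_uminus Const_1)
  moreover have "T + emb (- u) = 0" by (simp add: u emb_uminus)
  ultimately show ?thesis unfolding span_prod_def by (intro prod_zero finite_lin_span) blast
qed

text \<open>Every factor has coefficient 1 at x_s. This permits dividing by F_s(x_s) in the upper
  half of the tower.\<close>

lemma span_prod_Var_nonzero: "span_prod s (emb (Var s)) \<noteq> 0"
proof -
  have "emb (Var s) + emb u \<noteq> 0" if "u \<in> lin_span s" for u :: "'a pol"
  proof
    assume "emb (Var s) + emb u = 0"
    then have "Var s + u = 0" by (simp flip: emb_add emb_0 add: emb_eq_iff)
    then have "(1::'a) = 0"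
      by (intro lin_span_Var_coeff[of 1 s u 0 0]) (use that in \<open>simp_all add: Const_1 Const_0 lin_span_zero\<close>)
    then show False by simp
  qed
  then show ?thesis by (simp add: span_prod_def finite_lin_span)
qed

text \<open>With \<open>F = span_prod s = \<Sum>\<^sub>b c\<^sub>b T\<^bsup>q^b\<^esup>\<close>, the quadratic form of \<open>(F(x\<^sub>1), \<dots>, F(x\<^bsub>2m\<^esub>))\<close>
  is a polynomial in the \<open>c\<^sub>b\<close> and the \<open>h\<^sub>k\<close> with \<open>k \<le> s\<close>. Since \<open>F(x\<^sub>i) = 0\<close> for \<open>i < s\<close>, its only
  summand that is not yet known to lie in \<open>K\<close> is \<open>F(x\<^bsub>2m+1-s\<^esub>) F(x\<^sub>s)\<close>.\<close>

lemma span_prod_dual_in_subfield: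
  fixes K :: "'a::{finite,field} pol fract set"
  assumes q: "q = card (UNIV :: 'a set)" "q = 2 ^ r" and K: "subfield_set K"
    and const: "\<And>c. emb (Const c) \<in> K" and vars: "\<And>j. j \<in> {1..<2*m + 1 - s} \<Longrightarrow> emb (Var j) \<in> K"
    and h: "\<And>k. k \<in> {1..s} \<Longrightarrow> emb (h_pol m q k) \<in> K" and s: "1 \<le> s" "s \<le> m"
  shows "span_prod s (emb (Var (2*m + 1 - s))) \<in> K"
proof -
  define x where "x j = (emb (Var j) :: 'a pol fract)" for j
  have two: "(1::'a) + 1 = 0" using two_eq_zero_finite_field[where ?'a = 'a] q by metis
  have frob: "(y + z) ^ (q ^ b) = y ^ (q ^ b) + z ^ (q ^ b)" for y z :: "'a pol fract" and b
    unfolding q(2) power_mult[symmetric] by (rule freshmans_dream_two[OF emb_two[OF two]])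
  have frob_sum: "(\<Sum>i\<in>A. f i) ^ (q ^ b) = (\<Sum>i\<in>A. f i ^ (q ^ b))" for f :: "nat \<Rightarrow> 'a pol fract" and A b
    unfolding q(2) power_mult[symmetric] by (rule freshmans_dream_two_sum[OF emb_two[OF two]])
  have "\<exists>c. (\<forall>b. c b \<in> K) \<and> (\<forall>T. span_prod s T = (\<Sum>b<s. c b * T ^ (q ^ b)))"
    by (rule span_prod_q_polynomial[OF q K const vars]) (use s in auto)
  then obtain c where c: "\<And>b. c b \<in> K" "\<And>T. span_prod s T = (\<Sum>b<s. c b * T ^ (q ^ b))"
    by blast
  \<comment> \<open>The form has coefficients in the prime field, so it commutes with Frobenius and
    yields a power of h_1.\<close>
  have quad_pow: "quad m (\<lambda>i. x i ^ (q ^ b)) \<in> K" for b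
  proof -
    have "quad m (\<lambda>i. x i ^ (q ^ b)) = emb (h_pol m q 1) ^ (q ^ b)"
      unfolding h_pol_1 emb_quad x_def by (simp add: quad_def frob_sum power_mult_distrib)
    then show ?thesis using h[of 1] s by (simp add: subfield_power[OF K])
  qed
  \<comment> \<open>Extracting the common Frobenius power leaves h with index l - j + 1, at most s
    because l < s. This fixes how many invariants are consumed.\<close>
  have bil_pow: "bil m (\<lambda>i. x i ^ (q ^ j)) (\<lambda>i. x i ^ (q ^ l)) \<in> K" if jl: "j < l" "l < s" for j l
  proof -
    have e: "x i ^ (q ^ l) = (x i ^ (q ^ (l - j))) ^ (q ^ j)" for i
      using jl by (simp flip: power_mult power_add)
    have "bil m (\<lambda>i. x i ^ (q ^ l)) (\<lambda>i. x i ^ (q ^ j)) = bil m (\<lambda>i. x i ^ q ^ (l - j)) x ^ (q ^ j)"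
      unfolding e by (simp only: bil_def frob_sum frob power_mult_distrib)
    also have "bil m (\<lambda>i. x i ^ q ^ (l - j)) x = emb (h_pol m q (Suc (l - j)))"
      using jl by (simp add: h_pol_Suc emb_bil emb_power x_def[abs_def])
    finally show ?thesis
      using h[of "Suc (l - j)"] jl by (simp add: bil_commute[of m _ "\<lambda>i. x i ^ (q ^ l)"] subfield_power[OF K])
  qed
  have FK: "span_prod s (x j) \<in> K" if "j \<in> {1..<2*m + 1 - s}" for j
    unfolding c(2) x_def by (intro subfield_intros[OF K] c vars that)
  have "quad m (\<lambda>i. span_prod s (x i)) \<in> K"
    unfolding c(2) quad_scaled_sum[OF finite_lessThan]
    by (intro subfield_intros[OF K] c quad_pow bil_pow) auto
  moreover have "quad m (\<lambda>i. span_prod s (x i)) =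
      span_prod s (x (2*m + 1 - s)) * span_prod s (x s) +
      (\<Sum>i\<in>{s<..m}. span_prod s (x (2*m + 1 - i)) * span_prod s (x i))"
  proof -
    have "quad m (\<lambda>i. span_prod s (x i)) =
        (\<Sum>i\<in>insert s {s<..m}. span_prod s (x (2*m + 1 - i)) * span_prod s (x i))"
      unfolding quad_def
    proof (intro sum.mono_neutral_right ballI)
      fix i assume "i \<in> {1..m} - insert s {s<..m}"
      then have "i \<in> {1..<s}" by auto
      then have "span_prod s (x i) = 0"
        unfolding x_def by (intro span_prod_eq_0 imageI Var_in_lin_span)
      then show "span_prod s (x (2*m + 1 - i)) * span_prod s (x i) = 0" by simp
    qed (use s in auto)
    then show ?thesis by simp
  qed
  moreover have "(\<Sum>i\<in>{s<..m}. span_prod s (x (2*m + 1 - i)) * span_prod s (x i)) \<in> K"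
    by (intro subfield_sum[OF K] subfield_mult[OF K] FK) (use s in auto)
  ultimately have "span_prod s (x (2*m + 1 - s)) * span_prod s (x s) \<in> K"
    using subfield_diff[OF K] by fastforce
  \<comment> \<open>The divisor lies in \<open>K\<close> because s <= m gives s < 2m + 1 -
    s.\<close>
  then have "span_prod s (x (2*m + 1 - s)) * span_prod s (x s) / span_prod s (x s) \<in> K"
    by (rule subfield_divide[OF K]) (use s in \<open>auto intro: FK\<close>)
  then have "span_prod s (x (2*m + 1 - s)) \<in> K"
    by (simp only: x_def nonzero_mult_div_cancel_right[OF span_prod_Var_nonzero])
  then show ?thesis by (simp only: x_def)
qed

section \<open>The invariant field\<close>

lemma subfield_invariant_field:
  assumes "\<And>g. g \<in> G \<Longrightarrow> g \<in> carrier_mat n n \<and> invertible_mat g"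
  shows "subfield_set (invariant_field n G)"
proof -
  have "subfield_set {f \<in> rat_funs n. act_fract g f = f}" if "g \<in> G" for g
    using assms[OF that] by (intro subfield_fixed subfield_rat_funs act_fract_hom_on) auto
  then show ?thesis
    using subfield_rat_funs[of n] unfolding invariant_field_def subfield_set_def by blast
qed

lemma emb_in_invariant_field:
  assumes "\<And>g. g \<in> G \<Longrightarrow> g \<in> carrier_mat n n \<and> invertible_mat g" "p \<in> polys n"
    "\<And>g. g \<in> G \<Longrightarrow> act_poly g p = p"
  shows "emb p \<in> invariant_field n G"
proof -
  have "act_fract g (emb p) = emb p" if "g \<in> G" for g
    using assms(1)[OF that] assms(3)[OF that] act_fract_emb[OF _ _ assms(2), of g] by simp
  then show ?thesis using emb_in_rat_funs[OF assms(2)] by (simp add: invariant_field_def)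
qed

lemma G1_carrier: "g \<in> G1 m \<Longrightarrow> g \<in> carrier_mat (2*m) (2*m) \<and> invertible_mat g"
  by (simp add: G1_def O_plus_def)

lemma h_pol_polys: "h_pol m q k \<in> polys (2*m)"
  unfolding h_pol_def by (auto intro!: polys_sum polys_add polys_mult polys_power polys_Var)

lemma orbit_product_polys:
  assumes two: "(1::'a::field) + 1 = 0" and i: "i \<in> {1..m+1}" "i \<le> 2*m"
  shows "orbit_product (G1 m :: 'a mat set) i \<in> polys (2*m)"
  unfolding orbit_product_def orbit_eq[OF assms] using i
  by (intro polys_prod) (auto simp: lin_span_def lin_form_def
      intro!: polys_add polys_sum polys_mult polys_Const polys_Var)

lemma orbit_product_1:
  assumes "(1::'a::{finite,field}) + 1 = 0" "m \<ge> 1"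
  shows "orbit_product (G1 m :: 'a mat set) 1 = Var 1"
proof -
  have "min 1 (2*m + 1 - 1) = 1" using assms by simp
  then show ?thesis
    unfolding orbit_product_def using orbit_eq[OF assms(1), of 1 m] assms(2) by (simp add: lin_span_1[simplified])
qed

lemma adjoin_subset_invariant_field:
  assumes q: "q = card (UNIV :: 'a::{finite,field} set)" "q = 2 ^ r" and m: "m \<ge> 1"
  shows "adjoin (orbit_product (G1 m) ` {1..m+1} \<union> h_pol m q ` {1..m-1}) \<subseteq> invariant_field (2*m) (G1 m :: 'a mat set)"
proof (rule adjoin_subset)
  have two: "(1::'a) + 1 = 0" using two_eq_zero_finite_field[where ?'a = 'a] q by metis
  show "subfield_set (invariant_field (2*m) (G1 m :: 'a mat set))"
    by (rule subfield_invariant_field) (rule G1_carrier)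
  show "Fract (Const c) 1 \<in> invariant_field (2*m) (G1 m)" for c :: 'a
    unfolding emb_def[symmetric]
    by (rule emb_in_invariant_field[OF G1_carrier polys_Const]) (simp_all add: act_poly_def subst_Const)
  fix p :: "'a pol" assume "p \<in> orbit_product (G1 m) ` {1..m+1} \<union> h_pol m q ` {1..m-1}"
  then consider i where "i \<in> {1..m+1}" "i \<le> 2*m" "p = orbit_product (G1 m) i" | k where "k \<ge> 1" "p = h_pol m q k"
    using m by fastforce
  then have "emb p \<in> invariant_field (2*m) (G1 m)"
  proof cases
    case 1
    then show ?thesis
      by (intro emb_in_invariant_field G1_carrier) (simp_all add: orbit_product_polys[OF two] orbit_product_invariant[OF two])
  next
    case 2
    then show ?thesis
      by (intro emb_in_invariant_field G1_carrier) (simp_all add: h_pol_polys h_pol_invariant[OF q] G1_def)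
  qed
  then show "Fract p 1 \<in> invariant_field (2*m) (G1 m)" by (simp add: emb_def)
qed

text \<open>One level of the descent: the shifts of x_i by \<open>lin_span s\<close> are realized by
  group elements fixing the lower field, and their number matches the degree of F_s(T) -
  F_s(x_i).\<close>

lemma invariant_tower_descent:
  fixes f :: "'a::{finite,field} pol fract"
  assumes q: "q = card (UNIV :: 'a set)" "q = 2 ^ r" and m: "m \<ge> 1" and k: "k < 2*m"
    and S: "S = orbit_product (G1 m) ` {1..m+1} \<union> h_pol m q ` {1..m-1}"
    and f: "f \<in> invariant_field (2*m) (G1 m)" "f \<in> tower (adjoin S) (Suc k)"
  shows "f \<in> tower (adjoin S) k"
proof -
  have two: "(1::'a) + 1 = 0" using two_eq_zero_finite_field[where ?'a = 'a] q by metis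
  define i where "i = Suc k"
  define s where "s = min i (2*m + 1 - i)"
  define K where "K = tower (adjoin S) k"
  have i: "i \<in> {1..2*m}" and s1: "s \<ge> 1" using k by (auto simp: i_def s_def)
  note adj = subfield_adjoin[of S]
  have K: "subfield_set K" unfolding K_def by (rule subfield_tower[OF adj])
  have vars: "emb (Var j) \<in> K" if "j \<in> {1..<i}" for j
    unfolding K_def by (rule tower_Var[OF adj]) (use that in \<open>auto simp: i_def\<close>)
  have const: "emb (Const c) \<in> K" for c
    unfolding K_def emb_def using tower_base[OF adj] const_in_adjoin by blast
  have gens: "emb p \<in> K" if "p \<in> S" for p
    unfolding K_def emb_def using tower_base[OF adj] gen_in_adjoin[OF that] by blast
  have inv: "adjoin S \<subseteq> invariant_field (2*m) (G1 m)"
    unfolding S by (rule adjoin_subset_invariant_field[OF q m])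
  define R where "R = (rat_funs (2*m) :: 'a pol fract set)"
  have R: "subfield_set R" unfolding R_def by (rule subfield_rat_funs)
  \<comment> \<open>The matrices act as homomorphisms only on \<open>R\<close>, so the tower has to
    stay inside the rational functions in 2m variables.\<close>
  have KR: "K \<subseteq> R" unfolding K_def
    by (rule tower_subset[OF adj R]) (use inv k in \<open>auto simp: invariant_field_def R_def intro!: emb_in_rat_funs polys_Var\<close>)
  have "f \<in> K"
  proof (rule fixed_in_base[OF K R KR, where t = "emb (Var i)" and U = "emb ` lin_span s"])
    show "emb (Var i) \<in> R" using i unfolding R_def by (intro emb_in_rat_funs polys_Var)
    show "finite (emb ` lin_span s :: 'a pol fract set)" by (intro finite_imageI finite_lin_span)
    show "emb ` lin_span s \<noteq> {}" using lin_span_zero by blast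
    show "emb ` lin_span s \<subseteq> K"
      by (auto simp: lin_span_def lin_form_def emb_sum emb_mult s_def
          intro!: subfield_sum[OF K] subfield_mult[OF K] const vars)
    show "f \<in> simple_ext K (emb (Var i))" using f(2) by (simp add: K_def i_def)
    have "span_prod s (emb (Var i)) \<in> K"
    proof (cases "i \<le> m + 1")
      case True
      then have "orbit_product (G1 m) i \<in> S" using i by (auto simp: S)
      then have "emb (orbit_product (G1 m) i) \<in> K" by (rule gens)
      moreover have "i \<in> {1..m+1}" "i \<le> 2*m" using True i by auto
      ultimately show ?thesis by (simp only: emb_orbit_product[OF two] s_def)
    next
      case False
      \<comment> \<open>Beyond m + 1 the index s is at most m - 1, so all of h_1, ..., h_s are among
        the generators.\<close>
      then have s: "s = 2*m + 1 - i" "s \<le> m - 1" "i = 2*m + 1 - s" using i by (auto simp: s_def)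
      have h: "emb (h_pol m q j) \<in> K" if "j \<in> {1..s}" for j
        by (rule gens) (use that s(2) in \<open>auto simp: S\<close>)
      have vars': "emb (Var j) \<in> K" if "j \<in> {1..<2*m + 1 - s}" for j
        using vars that s(3) by simp
      have "span_prod s (emb (Var (2*m + 1 - s))) \<in> K"
        by (rule span_prod_dual_in_subfield[OF q K const vars' h s1]) (use s(2) in simp_all)
      then show ?thesis by (simp only: s(3)[symmetric])
    qed
    moreover have "inj_on emb A" for A :: "'a pol set" by (auto simp: inj_on_def emb_eq_iff)
    ultimately show "(\<Prod>u\<in>emb ` lin_span s. emb (Var i) + u) \<in> K"
      by (subst prod.reindex) (simp_all add: span_prod_def)
  next
    fix u assume "u \<in> (emb ` lin_span s :: 'a pol fract set)"
    then obtain c where u: "u = emb (lin_form {1..<s} c)" by (auto simp: lin_span_def)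
    \<comment> \<open>The coefficients of \<open>u\<close> serve as parameters, which makes
      \<open>g\<close> shift x_i by exactly \<open>u\<close>.\<close>
    define g where "g = transv m i c"
    have g: "g \<in> G1 m" unfolding g_def by (rule transv_G1[OF two i])
    note gC = G1_carrier[OF g, THEN conjunct1] G1_carrier[OF g, THEN conjunct2]
    have hom: "hom_on R (act_fract g)" unfolding R_def by (rule act_fract_hom_on[OF gC])
    have act: "act_fract g (emb (Var j)) = emb (act_var g j)" if "j \<in> {1..2*m}" for j
      using act_fract_emb[OF gC polys_Var[OF that]] by (simp add: act_poly_Var)
    \<comment> \<open>The fixed elements form a subfield; it contains the invariant generators and
      the variables x_1, ..., x_{i-1}, hence all of \<open>K\<close>.\<close>
    have "K \<subseteq> {x \<in> R. act_fract g x = x}"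
      unfolding K_def
    proof (rule tower_subset[OF adj])
      show "subfield_set {x \<in> R. act_fract g x = x}" by (rule subfield_fixed[OF R hom])
      show "adjoin S \<subseteq> {x \<in> R. act_fract g x = x}"
        using inv g by (auto simp: invariant_field_def R_def)
      fix j assume "j \<in> {1..k}"
      then have j: "j \<in> {1..<i}" "j \<in> {1..2*m}" using k by (auto simp: i_def)
      then show "emb (Var j) \<in> {x \<in> R. act_fract g x = x}"
        using act[OF j(2)] act_var_transv(2)[OF two i j(1)]
        by (auto simp: R_def g_def intro!: emb_in_rat_funs polys_Var)
    qed
    moreover have "act_fract g (emb (Var i)) = emb (Var i) + u"
      using act[OF i] act_var_transv(1)[OF two i] by (simp add: u g_def s_def emb_add)
    moreover have "act_fract g f = f" using f(1) g by (simp add: invariant_field_def)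
    ultimately show "\<exists>\<sigma>. hom_on R \<sigma> \<and> (\<forall>x\<in>K. \<sigma> x = x) \<and> \<sigma> (emb (Var i)) = emb (Var i) + u \<and> \<sigma> f = f"
      using hom by blast
  qed
  then show ?thesis by (simp add: K_def)
qed

theorem lemma4p17:
  fixes m q r :: nat
  assumes "m \<ge> 1" and "q = card (UNIV :: 'a::{finite,field} set)" and "q = 2 ^ r"
  shows "invariant_field (2*m) (G1 m :: 'a mat set) =
           adjoin (orbit_product (G1 m) ` {1..m+1} \<union> h_pol m q ` {1..m-1})
       \<and> invariant_field (2*m) (G1 m :: 'a mat set) =
           adjoin ({Var 1} \<union> orbit_product (G1 m) ` {2..m+1} \<union> h_pol m q ` {1..m-1})"
proof -
  have two: "(1::'a) + 1 = 0" using two_eq_zero_finite_field[where ?'a = 'a] assms by metis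
  define S :: "'a pol set" where "S = orbit_product (G1 m) ` {1..m+1} \<union> h_pol m q ` {1..m-1}"
  \<comment> \<open>Since N(x_1) = x_1, both descriptions in the statement use the same generating
    set.\<close>
  have "{1..m+1} = insert 1 {2..m+1}" by auto
  then have S': "S = {Var 1} \<union> orbit_product (G1 m) ` {2..m+1} \<union> h_pol m q ` {1..m-1}"
    unfolding S_def using orbit_product_1[OF two assms(1)] by simp
  have "invariant_field (2*m) (G1 m :: 'a mat set) \<subseteq> adjoin S"
  proof
    fix f :: "'a pol fract" assume f: "f \<in> invariant_field (2*m) (G1 m)"
    note adj = subfield_adjoin[of S]
    have "rat_funs (2*m) \<subseteq> tower (adjoin S) (2*m)"
      using tower_base[OF adj] const_in_adjoin[of _ S]
      by (intro rat_funs_subset subfield_tower[OF adj] tower_Var[OF adj]) (auto simp: emb_def)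
    then have "f \<in> tower (adjoin S) (2*m)" using f by (auto simp: invariant_field_def)
    \<comment> \<open>Here \<open>j\<close> counts the levels already descended; past 2m the
      truncated subtraction stays at level 0 and the induction step is trivial.\<close>
    then have "f \<in> tower (adjoin S) (2*m - j)" for j
    proof (induction j)
      case (Suc j)
      show ?case
      proof (cases "j < 2*m")
        case True
        then have less: "2*m - Suc j < 2*m" and "2*m - j = Suc (2*m - Suc j)" by auto
        then have "f \<in> tower (adjoin S) (Suc (2*m - Suc j))" using Suc by (simp only:)
        then show ?thesis by (rule invariant_tower_descent[OF assms(2,3,1) less S_def f])
      qed (use Suc in simp)
    qed simp
    from this[of "2*m"] show "f \<in> adjoin S" by simp
  qed
  moreover have "adjoin S \<subseteq> invariant_field (2*m) (G1 m)"
    unfolding S_def by (rule adjoin_subset_invariant_field[OF assms(2,3,1)])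
  ultimately have "invariant_field (2*m) (G1 m) = adjoin S" by (rule equalityI)
  then show ?thesis unfolding S_def[symmetric] S'[symmetric] by (intro conjI)
qed

end
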